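(* Let Assumption B (in the context) hold. Then the Kalman filter, applied to Data Model 2, yields a bias-variance decomposition of the mean squared error $$\mathbb{E}\|m_n-u^\dagger\|^2\le C\left(\frac{\alpha}{n}\right)^{\frac{2\beta}{1+2\epsilon+2p}}+\gamma^2\left(\frac{n}{\alpha}\right)^{\frac{1+2p}{1+2\epsilon+2p}}.$$ Fix $\alpha=1$ and assume that the noise variance is $\gamma^2=N^{-\frac{1+2\beta+2p}{1+2\epsilon+2p}}$. If the iteration is stopped at $n=N$ then the following convergence rate is valid: $$\mathbb{E}\|m_N-u^\dagger\|^2\le C\,N^{-\frac{2\beta}{1+2\epsilon+2p}}.$$ Here $C$ denotes a generic constant (possibly different in the two bounds), independent of $\gamma$ and of the iteration number $n$ (respectively $N$).
   Context: $X,Y$ are Hilbert spaces, $A$ is a compact linear operator from $X$ to $Y$, $u^\dagger\in X$ is a fixed (deterministic) element, the truth, $\gamma>0$, $\alpha>0$, and $\|\cdot\|$ is the norm of $X$. $\mathcal{N}(0,\gamma^2 I)$ is the centred Gaussian on $Y$ with covariance $\gamma^2 I$ (Gaussian white noise if $Y$ is infinite dimensional, so that $\mathbb{E}\|F\eta\|^2=\gamma^2\,\mathrm{tr}(FF^* )$ for $\eta\sim\mathcal{N}(0,\gamma^2I)$ and a bounded linear $F:Y\to X$). Data Model 2: $y_n=y$ for all $n\ge1$, where $y=Au^\dagger+\eta$ with a single draw $\eta\sim\mathcal{N}(0,\gamma^2I)$; the expectation is over $\eta$. Kalman filter: given the initial mean $m_0\in X$ and initial covariance $C_0$, for $n\ge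 1$ $$K_n=C_{n-1}A^*(AC_{n-1}A^*+\gamma^2I)^{-1},\quad m_n=m_{n-1}+K_n(y_n-Am_{n-1}),\quad C_n=(I-K_nA)C_{n-1}.$$ Assumption B: $C_0=\frac{\gamma^2}{\alpha}\Sigma_0$. The operators $\Sigma_0$ and $A^*A$ have the same eigenfunctions $\{e_i\}_{i\ge1}$ (an orthonormal basis of $X$), with respective eigenvalues $\{\lambda_i\}$ and $\{\kappa_i^2\}$ satisfying $\lambda_i=i^{-1-2\epsilon}$ and $c^{-1}i^{-p}\le\kappa_i\le c\,i^{-p}$ for some $\epsilon>0$, $p>0$, $c\ge1$. The initial mean is $m_0=0$, and the coordinates $u^{\dagger,i}$ of $u^\dagger$ in the basis $\{e_i\}$ satisfy $\sum_{i=1}^\infty(u^{\dagger,i})^2i^{2\beta}<\infty$, where $0\le\beta\le1+2\epsilon+p$.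
   Formalization: In the first bound the generic constant C multiplies the variance term as well as the bias term; with coefficient exactly 1 on the variance term the bound fails, e.g. for κ_i = s i^{-p} with s small, α = 1, n = s^{-2} and γ large. *)

theory Defs
  imports "HOL-Probability.Probability"
begin

definition compact_operator ::
  "('x::real_normed_vector \<Rightarrow> 'y::real_normed_vector) \<Rightarrow> bool" where
  "compact_operator A \<longleftrightarrow> linear A \<and> (\<forall>S. bounded S \<longrightarrow> compact (closure (A ` S)))"

definition orthonormal_basis :: "'i set \<Rightarrow> ('i \<Rightarrow> 'x::real_inner) \<Rightarrow> bool" where
  "orthonormal_basis I e \<longleftrightarrow>
     (\<forall>i\<in>I. \<forall>j\<in>I. e i \<bullet> e j = (if i = j then 1 else 0)) \<and> closure (span (e ` I)) = UNIV"

text \<open>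
  In infinite dimensions the Gaussian \<open>N(0, \<gamma>\<^sup>2 I)\<close> is not carried by \<open>'y\<close>. A generalised random
  element \<open>g\<close> of \<open>'y\<close> is therefore given by its pairings: \<open>g h \<omega>\<close> stands for
  \<open>\<langle>g(\<omega>), h\<rangle>\<close>. Since \<open>\<eta>\<close> is almost surely linear in \<open>h\<close>, the marginal laws below determine all
  joint laws, and the covariance of \<open>\<eta> h\<close> and \<open>\<eta> k\<close> is \<open>\<gamma>\<^sup>2 (h \<bullet> k)\<close>. The case \<open>h = 0\<close>, for which
  there is no density, is covered by linearity.
\<close>

definition white_noise :: "'w measure \<Rightarrow> real \<Rightarrow> ('y::real_inner \<Rightarrow> 'w \<Rightarrow> real) \<Rightarrow> bool" where
  "white_noise M \<gamma> \<eta> \<longleftrightarrow>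
     (\<forall>h. \<eta> h \<in> borel_measurable M) \<and>
     (\<forall>h k a. AE \<omega> in M. \<eta> (h + a *\<^sub>R k) \<omega> = \<eta> h \<omega> + a * \<eta> k \<omega>) \<and>
     (\<forall>h. h \<noteq> 0 \<longrightarrow> distributed M lborel (\<eta> h) (normal_density 0 (\<gamma> * norm h)))"

text \<open>
  The image \<open>F g\<close> of a generalised random element under a bounded operator \<open>F\<close>, as a genuine random
  variable with values in \<open>'x\<close>: \<open>\<langle>F g, x\<rangle> = \<langle>g, F\<^sup>* x\<rangle>\<close> almost surely, for every \<open>x\<close>. On a separable
  space two such variables agree almost surely; one exists for white noise when \<open>F\<close> is
  Hilbert-Schmidt.
\<close>

definition apply_operator ::
  "'w measure \<Rightarrow> ('y::real_inner \<Rightarrow> 'x::real_inner) \<Rightarrow> ('y \<Rightarrow> 'w \<Rightarrow> real) \<Rightarrow> 'w \<Rightarrow> 'x" where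
  "apply_operator M F g =
     (SOME Z. Z \<in> borel_measurable M \<and> (\<forall>x. AE \<omega> in M. Z \<omega> \<bullet> x = g (adjoint F x) \<omega>))"

definition kalman_gain ::
  "('x::real_inner \<Rightarrow> 'y::real_inner) \<Rightarrow> real \<Rightarrow> ('x \<Rightarrow> 'x) \<Rightarrow> 'y \<Rightarrow> 'x" where
  "kalman_gain A \<gamma> C =
     C \<circ> adjoint A \<circ> inv (\<lambda>v. A (C (adjoint A v)) + \<gamma>\<^sup>2 *\<^sub>R v)"

primrec kalman_cov ::
  "('x::real_inner \<Rightarrow> 'y::real_inner) \<Rightarrow> real \<Rightarrow> ('x \<Rightarrow> 'x) \<Rightarrow> nat \<Rightarrow> 'x \<Rightarrow> 'x" where
  "kalman_cov A \<gamma> C0 0 = C0"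
| "kalman_cov A \<gamma> C0 (Suc n) =
     (\<lambda>x. kalman_cov A \<gamma> C0 n x
        - kalman_gain A \<gamma> (kalman_cov A \<gamma> C0 n) (A (kalman_cov A \<gamma> C0 n x)))"

text \<open>The data \<open>y n\<close>, \<open>n \<ge> 1\<close>, are generalised random elements of \<open>'y\<close>.\<close>

primrec kalman_mean ::
  "'w measure \<Rightarrow> ('x::real_inner \<Rightarrow> 'y::real_inner) \<Rightarrow> real \<Rightarrow> ('x \<Rightarrow> 'x) \<Rightarrow> 'x
     \<Rightarrow> (nat \<Rightarrow> 'y \<Rightarrow> 'w \<Rightarrow> real) \<Rightarrow> nat \<Rightarrow> 'w \<Rightarrow> 'x" where
  "kalman_mean M A \<gamma> C0 m0 y 0 = (\<lambda>\<omega>. m0)"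
| "kalman_mean M A \<gamma> C0 m0 y (Suc n) =
     (\<lambda>\<omega>. kalman_mean M A \<gamma> C0 m0 y n \<omega>
        + apply_operator M (kalman_gain A \<gamma> (kalman_cov A \<gamma> C0 n))
            (\<lambda>h \<omega>'. y (Suc n) h \<omega>' - A (kalman_mean M A \<gamma> C0 m0 y n \<omega>') \<bullet> h) \<omega>)"

text \<open>Data \<open>y n = A u + \<eta>\<close> with the same draw of \<open>\<eta>\<close> for every \<open>n\<close>.\<close>

definition single_draw_data ::
  "('x \<Rightarrow> 'y::real_inner) \<Rightarrow> 'x \<Rightarrow> ('y \<Rightarrow> 'w \<Rightarrow> real) \<Rightarrow> nat \<Rightarrow> 'y \<Rightarrow> 'w \<Rightarrow> real" where
  "single_draw_data A u \<eta> n h \<omega> = A u \<bullet> h + \<eta> h \<omega>"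

end

(*
  Let E_i be the common eigenbasis and F_i = A E_i / kappa_i. All operators of the filter are diagonal
  in these two orthonormal systems, and since the data are the same at every step, the recursion for
  the i-th coordinate is solved by a Tikhonov filter with regularisation alpha/n:
    <m_n, E_i> = t mu_i kappa_i / (1 + t mu_i kappa_i^2) * (kappa_i <u, E_i> + <eta, F_i>),  t = n/alpha,
  where mu_i are the eigenvalues of Sigma_0. By Parseval's identity the mean squared error is at most
  twice the sum of (1 + t mu_i kappa_i^2)^-2 <u, E_i>^2 and of gamma^2 times the squared filter factors;
  with mu_i kappa_i^2 ~ i^-s, s = 1 + 2 epsilon + 2 p, the first is estimated termwise and the second by
  splitting the sum at i = t^(1/s).
*)

theory Submission
  imports Defs
begin

section \<open>Orthonormal series\<close>

text \<open>The noise is not an element of \<open>'y\<close>, so \<open>apply_operator\<close>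
  merely chooses a random variable with prescribed pairings. Nothing is known about an update of the
  mean until such a variable is exhibited. The witness is a random series in the eigenbasis; it
  converges almost surely because the singular values of every gain are square summable, which
  follows from \<open>\<mu> i * \<kappa> i\<close> decaying like i^(-1 - 2\<epsilon> - p). The
  chosen variable has the right pairing with each vector only off a null set depending on that
  vector; the countably many basis vectors suffice, since the norm is recovered from them. The
  second obstacle is that the system \<open>F\<close> need not span the data space. Preimages and
  adjoints there are therefore written down explicitly, and only their coordinates along
  \<open>F\<close> are compared. The factor two in the error bound pays for the cross term between
  bias and noise, so that only second moments of the single variables \<open>\<eta> (F i)\<close>
  enter and every interchange of sum and expectation concerns nonnegative terms.\<close>

definition orthonormal_seq :: "(nat \<Rightarrow> 'a::real_inner) \<Rightarrow> bool" where
  "orthonormal_seq f \<longleftrightarrow> (\<forall>i j. f i \<bullet> f j = (if i = j then 1 else 0))"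

lemma orthonormal_seq_inner:
  "orthonormal_seq f \<Longrightarrow> f i \<bullet> f j = (if i = j then 1 else 0)"
  by (simp add: orthonormal_seq_def)

lemma orthonormal_seq_inner_sum:
  assumes "orthonormal_seq f" "finite I"
  shows "(\<Sum>i\<in>I. a i *\<^sub>R f i) \<bullet> f j = (if j \<in> I then a j else 0)"
  using assms by (simp add: inner_sum_left orthonormal_seq_inner if_distrib cong: if_cong)

lemma orthonormal_seq_norm_sum:
  assumes "orthonormal_seq f" "finite I"
  shows "(norm (\<Sum>i\<in>I. a i *\<^sub>R f i))\<^sup>2 = (\<Sum>i\<in>I. (a i)\<^sup>2)"
proof -
  have "(norm (\<Sum>i\<in>I. a i *\<^sub>R f i))\<^sup>2 = (\<Sum>j\<in>I. a j * ((\<Sum>i\<in>I. a i *\<^sub>R f i) \<bullet> f j))"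
    by (simp add: power2_norm_eq_inner inner_sum_right)
  also have "\<dots> = (\<Sum>j\<in>I. (a j)\<^sup>2)"
    by (rule sum.cong) (simp_all add: orthonormal_seq_inner_sum[OF assms] power2_eq_square)
  finally show ?thesis .
qed

text \<open>Riesz-Fischer: by Pythagoras, the squared distance of two partial sums is a section of
  the series of squares, so the partial sums are Cauchy.\<close>

lemma orthonormal_seq_summable:
  fixes f :: "nat \<Rightarrow> 'a::{real_inner, complete_space}"
  assumes f: "orthonormal_seq f" and a: "summable (\<lambda>i. (a i)\<^sup>2)"
  shows "summable (\<lambda>i. a i *\<^sub>R f i)"
proof -
  define S where "S n = (\<Sum>i<n. a i *\<^sub>R f i)" for n
  have diff: "(dist (S m) (S n))\<^sup>2 = (\<Sum>i=m..<n. (a i)\<^sup>2)" if "m \<le> n" for m n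
  proof -
    have "S n - S m = (\<Sum>i=m..<n. a i *\<^sub>R f i)"
      using sum_diff_nat_ivl[of 0 m n "\<lambda>i. a i *\<^sub>R f i"] that
      by (simp add: S_def lessThan_atLeast0)
    then show ?thesis
      using orthonormal_seq_norm_sum[OF f, of "{m..<n}" a]
      by (simp add: dist_norm norm_minus_commute[of "S m" "S n"])
  qed
  have "Cauchy S"
  proof (rule metric_CauchyI)
    fix r :: real
    assume "r > 0"
    then obtain N where N: "norm (\<Sum>i=m..<n. (a i)\<^sup>2) < r\<^sup>2" if "m \<ge> N" for m n
      using a unfolding summable_Cauchy by (meson zero_less_power)
    have le: "dist (S m) (S n) < r" if "N \<le> m" "m \<le> n" for m n
    proof -
      have "(dist (S m) (S n))\<^sup>2 < r\<^sup>2"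
        using N[of m n] that by (simp add: diff abs_less_iff)
      then show ?thesis
        using \<open>r > 0\<close> power2_less_imp_less by fastforce
    qed
    show "\<exists>N. \<forall>m\<ge>N. \<forall>n\<ge>N. dist (S m) (S n) < r"
      by (metis le dist_commute nle_le)
  qed
  then have "convergent S"
    by (simp add: Cauchy_convergent_iff)
  then show ?thesis
    by (simp add: summable_iff_convergent S_def[abs_def])
qed

lemma sums_inner_right:
  "f sums s \<Longrightarrow> (\<lambda>i. x \<bullet> f i) sums (x \<bullet> s)"
  by (rule bounded_linear.sums[OF bounded_linear_inner_right])

lemma sums_inner_left:
  "f sums s \<Longrightarrow> (\<lambda>i. f i \<bullet> x) sums (s \<bullet> x)"
  by (rule bounded_linear.sums[OF bounded_linear_inner_left])

lemma orthonormal_seq_sums_inner: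
  assumes "orthonormal_seq f" "(\<lambda>i. a i *\<^sub>R f i) sums s"
  shows "s \<bullet> f j = a j"
proof -
  have "(\<lambda>i. if i = j then a i else 0) sums (s \<bullet> f j)"
    using sums_inner_left[OF assms(2), of "f j"]
    by (simp add: orthonormal_seq_inner[OF assms(1)] if_distrib cong: if_cong)
  then show ?thesis
    using sums_single[of j a] sums_unique2 by blast
qed

lemma bessel_sum:
  assumes "orthonormal_seq f" "finite I"
  shows "(\<Sum>i\<in>I. (x \<bullet> f i)\<^sup>2) \<le> (norm x)\<^sup>2"
proof -
  define s where "s = (\<Sum>i\<in>I. (x \<bullet> f i) *\<^sub>R f i)"
  have "(norm s)\<^sup>2 = (\<Sum>i\<in>I. (x \<bullet> f i)\<^sup>2)"
    unfolding s_def by (rule orthonormal_seq_norm_sum[OF assms])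
  moreover have "x \<bullet> s = (\<Sum>i\<in>I. (x \<bullet> f i)\<^sup>2)"
    by (simp add: s_def inner_sum_right power2_eq_square)
  moreover have "0 \<le> (norm (x - s))\<^sup>2"
    by simp
  ultimately show ?thesis
    by (simp add: power2_norm_eq_inner inner_diff_left inner_diff_right inner_commute)
qed

lemma bessel_le: "orthonormal_seq f \<Longrightarrow> (x \<bullet> f i)\<^sup>2 \<le> (norm x)\<^sup>2"
  using bessel_sum[of f "{i}" x] by simp

lemma bessel_summable: "orthonormal_seq f \<Longrightarrow> summable (\<lambda>i. (x \<bullet> f i)\<^sup>2)"
  by (rule summableI_nonneg_bounded[of _ "(norm x)\<^sup>2"]) (simp_all add: bessel_sum)

lemma bessel_summable_mult:
  assumes "orthonormal_seq f" "summable (\<lambda>i. (k i)\<^sup>2)"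
  shows "summable (\<lambda>i. (k i * (x \<bullet> f i))\<^sup>2)"
proof (rule summable_comparison_test_ev[OF always_eventually])
  show "summable (\<lambda>i. (k i)\<^sup>2 * (norm x)\<^sup>2)"
    using assms(2) by (rule summable_mult2)
qed (auto simp: power_mult_distrib intro!: mult_left_mono bessel_le[OF assms(1)])

section \<open>Complete orthonormal systems: expansion, adjoints, measurability\<close>

locale hilbert_basis =
  fixes E :: "nat \<Rightarrow> 'x::{real_inner, complete_space}"
  assumes ortho: "orthonormal_seq E"
    and dense: "closure (span (range E)) = UNIV"
begin

lemma linear_eq_0:
  fixes L :: "'x \<Rightarrow> 'b::real_normed_vector"
  assumes L: "bounded_linear L" and 0: "\<And>i. L (E i) = 0"
  shows "L x = 0"
proof -
  interpret L: bounded_linear L by fact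
  have "span (range E) \<subseteq> {z. L z = 0}"
    by (rule span_minimal)
      (auto simp: 0 subspace_def L.add L.scaleR)
  moreover have "closed {z. L z = 0}"
    by (intro closed_Collect_eq continuous_intros L.continuous_on)
  ultimately have "closure (span (range E)) \<subseteq> {z. L z = 0}"
    by (simp add: closure_minimal)
  then show ?thesis
    using dense by auto
qed

lemma linear_eqI:
  fixes L :: "'x \<Rightarrow> 'b::real_normed_vector"
  assumes "bounded_linear L" "bounded_linear L'" "\<And>i. L (E i) = L' (E i)"
  shows "L x = L' x"
  using linear_eq_0[OF bounded_linear_sub[OF assms(1,2)]] assms(3) by simp

lemma coord_eqI:
  assumes "\<And>i. x \<bullet> E i = y \<bullet> E i"
  shows "x = y"
proof -
  have "x \<bullet> z = y \<bullet> z" for z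
    by (rule linear_eqI[of "\<lambda>z. x \<bullet> z" "\<lambda>z. y \<bullet> z"])
      (simp_all add: assms bounded_linear_inner_right)
  then show ?thesis
    using vector_eq_rdot[of x y] by simp
qed

text \<open>Bessel's inequality gives convergence to some limit; the limit has the coordinates of
  \<open>x\<close>, and density of the span lets coordinates determine a vector.\<close>

lemma expansion: "(\<lambda>i. (x \<bullet> E i) *\<^sub>R E i) sums x"
proof -
  obtain s where s: "(\<lambda>i. (x \<bullet> E i) *\<^sub>R E i) sums s"
    using orthonormal_seq_summable[OF ortho bessel_summable[OF ortho]] by (auto simp: summable_def)
  then have "s = x"
    by (intro coord_eqI) (rule orthonormal_seq_sums_inner[OF ortho])
  with s show ?thesis by simp
qed

lemma parseval_inner: "(\<lambda>i. (x \<bullet> E i) * (y \<bullet> E i)) sums (x \<bullet> y)"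
  using sums_inner_left[OF expansion, of x y] by (simp add: inner_commute)

lemma parseval: "(\<lambda>i. (x \<bullet> E i)\<^sup>2) sums (norm x)\<^sup>2"
  using parseval_inner[of x x] unfolding power2_norm_eq_inner by (simp add: power2_eq_square)

lemma exists_coords:
  assumes "summable (\<lambda>i. (a i)\<^sup>2)"
  shows "\<exists>x. \<forall>i. x \<bullet> E i = a i"
  using orthonormal_seq_summable[OF ortho assms] orthonormal_seq_sums_inner[OF ortho]
  by (auto simp: summable_def)

text \<open>\<open>adjoint\<close> is defined by choice, so its defining property rests on the
  existence of some adjoint. The basis provides it in the manner of Riesz: the image of
  \<open>y\<close> must have the coordinates \<open>A (E i) \<bullet> y\<close>, and these are
  square summable because testing \<open>A\<close> on their own partial sum v gives norm v ^ 2 \<le>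
  onorm A * norm v * norm y.\<close>

lemma adjoint_works_hilbert:
  fixes A :: "'x \<Rightarrow> 'y::real_inner"
  assumes "bounded_linear A"
  shows "A x \<bullet> y = x \<bullet> adjoint A y"
proof -
  interpret A: bounded_linear A by fact
  have "\<exists>z. \<forall>x. A x \<bullet> y = x \<bullet> z" for y
  proof -
    define a where "a i = A (E i) \<bullet> y" for i
    have "(\<Sum>i<n. (a i)\<^sup>2) \<le> (onorm A * norm y)\<^sup>2" for n
    proof -
      define v where "v = (\<Sum>i<n. a i *\<^sub>R E i)"
      define S where "S = (\<Sum>i<n. (a i)\<^sup>2)"
      have S: "S = (norm v)\<^sup>2"
        unfolding v_def S_def by (simp add: orthonormal_seq_norm_sum[OF ortho])
      have "S = A v \<bullet> y"
        by (simp add: S_def v_def A.sum A.scaleR inner_sum_left a_def power2_eq_square)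
      also have "\<dots> \<le> norm (A v) * norm y"
        by (rule norm_cauchy_schwarz)
      also have "\<dots> \<le> onorm A * norm v * norm y"
        by (intro mult_right_mono onorm[OF assms]) simp
      finally have "norm v * norm v \<le> norm v * (onorm A * norm y)"
        by (simp add: S power2_eq_square mult_ac)
      then have "norm v \<le> onorm A * norm y"
        by (cases "v = 0") (auto simp: onorm_pos_le[OF assms])
      then show ?thesis
        unfolding S_def[symmetric] S by (simp add: power_mono)
    qed
    then have "summable (\<lambda>i. (a i)\<^sup>2)"
      by (intro summableI_nonneg_bounded) auto
    then obtain z where z: "\<And>i. z \<bullet> E i = a i"
      using exists_coords by blast
    have "A x \<bullet> y = x \<bullet> z" for x
    proof (rule linear_eqI[where L = "\<lambda>x. A x \<bullet> y" and L' = "\<lambda>x. x \<bullet> z"])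
      show "bounded_linear (\<lambda>x. A x \<bullet> y)"
        by (rule bounded_linear_inner_left_comp[OF assms])
      show "A (E i) \<bullet> y = E i \<bullet> z" for i
        using z[of i] by (simp add: a_def inner_commute)
    qed (rule bounded_linear_inner_left)
    then show ?thesis by blast
  qed
  then obtain g where "\<forall>x y. A x \<bullet> y = x \<bullet> g y"
    by metis
  then show ?thesis
    using adjoint_unique by metis
qed

lemma bounded_linear_diagonal:
  assumes "bounded_linear S" "\<And>i. S (E i) = a i *\<^sub>R E i"
  shows "S x \<bullet> E j = a j * (x \<bullet> E j)"
proof (rule linear_eqI[where L = "\<lambda>x. S x \<bullet> E j" and L' = "\<lambda>x. a j * (x \<bullet> E j)"])
  show "bounded_linear (\<lambda>x. S x \<bullet> E j)"
    by (rule bounded_linear_inner_left_comp[OF assms(1)])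
  show "bounded_linear (\<lambda>x. a j * (x \<bullet> E j))"
    by (intro bounded_linear_const_mult bounded_linear_inner_left)
  show "S (E i) \<bullet> E j = a j * (E i \<bullet> E j)" for i
    by (simp add: assms(2) orthonormal_seq_inner[OF ortho])
qed

text \<open>The type \<open>'x\<close> is not declared second countable, so vector-valued
  measurability is reduced to real functions: \<open>Z\<close> is the pointwise limit of its partial
  expansions, each a continuous function of the sequence of coordinates.\<close>

lemma borel_measurable_coords:
  assumes "\<And>i. (\<lambda>\<omega>. Z \<omega> \<bullet> E i) \<in> borel_measurable M"
  shows "Z \<in> borel_measurable M"
proof (rule borel_measurable_LIMSEQ_metric)
  fix n
  \<comment> \<open>Here \<open>g\<close> ranges over real sequences with the product topology,
    whose Borel sets are generated coordinatewise.\<close>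
  have "continuous_on UNIV (\<lambda>g. \<Sum>i<n. (g i :: real) *\<^sub>R E i)"
    by (intro continuous_intros continuous_on_product_coordinates)
  then have "(\<lambda>g. \<Sum>i<n. (g i :: real) *\<^sub>R E i) \<in> borel_measurable borel"
    by (rule borel_measurable_continuous_onI)
  from measurable_compose[OF measurable_coordinatewise_then_product this, of "\<lambda>\<omega> i. Z \<omega> \<bullet> E i"]
  show "(\<lambda>\<omega>. \<Sum>i<n. (Z \<omega> \<bullet> E i) *\<^sub>R E i) \<in> borel_measurable M"
    using assms by simp
next
  show "(\<lambda>n. \<Sum>i<n. (Z \<omega> \<bullet> E i) *\<^sub>R E i) \<longlonglongrightarrow> Z \<omega>" for \<omega>
    using expansion[of "Z \<omega>"] by (simp add: sums_def)
qed

end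

lemma borel_measurable_inner_left:
  "Z \<in> borel_measurable M \<Longrightarrow> (\<lambda>\<omega>. Z \<omega> \<bullet> x) \<in> borel_measurable M"
  by (rule measurable_compose[OF _ borel_measurable_continuous_onI[of "\<lambda>z. z \<bullet> x"]])
    (auto intro: continuous_intros)

section \<open>White noise\<close>

lemma white_noise_measurable: "white_noise M \<gamma> \<eta> \<Longrightarrow> \<eta> h \<in> borel_measurable M"
  by (simp add: white_noise_def)

lemma white_noise_add:
  "white_noise M \<gamma> \<eta> \<Longrightarrow> AE \<omega> in M. \<eta> (h + a *\<^sub>R k) \<omega> = \<eta> h \<omega> + a * \<eta> k \<omega>"
  by (simp add: white_noise_def)

lemma white_noise_zero:
  assumes "white_noise M \<gamma> \<eta>"
  shows "AE \<omega> in M. \<eta> 0 \<omega> = 0"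
  using white_noise_add[OF assms, of 0 1 0] by simp

lemma white_noise_scaleR:
  assumes "white_noise M \<gamma> \<eta>"
  shows "AE \<omega> in M. \<eta> (a *\<^sub>R k) \<omega> = a * \<eta> k \<omega>"
  using white_noise_add[OF assms, of 0 a k] white_noise_zero[OF assms] by eventually_elim simp

lemma white_noise_sum:
  fixes n :: nat
  assumes "white_noise M \<gamma> \<eta>"
  shows "AE \<omega> in M. \<eta> (\<Sum>i<n. a i *\<^sub>R f i) \<omega> = (\<Sum>i<n. a i * \<eta> (f i) \<omega>)"
proof (induction n)
  case 0
  then show ?case using white_noise_zero[OF assms] by simp
next
  case (Suc n)
  then show ?case
    using white_noise_add[OF assms, of "\<Sum>i<n. a i *\<^sub>R f i" "a n" "f n"] by eventually_elim simp
qed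

text \<open>This makes \<open>\<eta>\<close> a multiple of an isometry into L^2. The nonnegative
  integral lets the identity be summed over coordinates before any integrability is known.\<close>

lemma white_noise_second_moment:
  assumes "prob_space M" and wn: "white_noise M \<gamma> \<eta>" and "\<gamma> > 0"
  shows "(\<integral>\<^sup>+\<omega>. ennreal ((\<eta> h \<omega>)\<^sup>2) \<partial>M) = ennreal (\<gamma>\<^sup>2 * (norm h)\<^sup>2)"
proof (cases "h = 0")
  case True
  have "(\<integral>\<^sup>+\<omega>. ennreal ((\<eta> 0 \<omega>)\<^sup>2) \<partial>M) = (\<integral>\<^sup>+\<omega>. 0 \<partial>M)"
    by (rule nn_integral_cong_AE) (use white_noise_zero[OF wn] in \<open>eventually_elim, simp\<close>)
  with True show ?thesis by simp
next
  case False
  define \<sigma> where "\<sigma> = \<gamma> * norm h"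
  have \<sigma>: "\<sigma> > 0"
    using False \<open>\<gamma> > 0\<close> by (simp add: \<sigma>_def)
  have D: "distributed M lborel (\<eta> h) (normal_density 0 \<sigma>)"
    using wn False by (simp add: white_noise_def \<sigma>_def)
  have "(\<integral>\<^sup>+\<omega>. ennreal ((\<eta> h \<omega>)\<^sup>2) \<partial>M) = (\<integral>\<^sup>+x. ennreal (normal_density 0 \<sigma> x) * ennreal (x\<^sup>2) \<partial>lborel)"
    by (rule distributed_nn_integral[OF D, symmetric]) simp
  also have "\<dots> = (\<integral>\<^sup>+x. ennreal (normal_density 0 \<sigma> x * x\<^sup>2) \<partial>lborel)"
    by (simp add: ennreal_mult)
  also have "\<dots> = ennreal (\<sigma>\<^sup>2)"
    using normal_moment_even[OF \<sigma>, of 0 1] \<sigma>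
    by (subst nn_integral_eq_integral)
      (auto simp: has_bochner_integral_iff fact_numeral)
  finally show ?thesis
    by (simp add: \<sigma>_def power_mult_distrib)
qed

text \<open>The partial sums converge to \<open>\<eta> h\<close> in \<open>L\<^sup>2\<close> because \<open>\<eta>\<close> is a multiple of an isometry;
  by Fatou's lemma, the almost sure limit is then the same.\<close>

lemma white_noise_sums:
  assumes "prob_space M" and wn: "white_noise M \<gamma> \<eta>" and "\<gamma> > 0"
    and h: "(\<lambda>i. a i *\<^sub>R f i) sums h"
  shows "AE \<omega> in M. \<forall>l. (\<lambda>i. a i * \<eta> (f i) \<omega>) sums l \<longrightarrow> \<eta> h \<omega> = l"
proof -
  define s where "s n = (\<Sum>i<n. a i *\<^sub>R f i)" for n
  note [measurable] = white_noise_measurable[OF wn]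
  define d where "d n \<omega> = ennreal ((\<eta> (h - s n) \<omega>)\<^sup>2)" for n \<omega>
  have d[measurable]: "d n \<in> borel_measurable M" for n
    unfolding d_def by measurable
  have "(\<lambda>n. \<gamma>\<^sup>2 * (norm (h - s n))\<^sup>2) \<longlonglongrightarrow> \<gamma>\<^sup>2 * (norm (h - h))\<^sup>2"
    using h unfolding sums_def s_def by (intro tendsto_intros)
  then have "(\<lambda>n. integral\<^sup>N M (d n)) \<longlonglongrightarrow> ennreal (\<gamma>\<^sup>2 * (norm (h - h))\<^sup>2)"
    unfolding d_def white_noise_second_moment[OF assms(1-3)] by (intro tendsto_ennrealI)
  then have "liminf (\<lambda>n. integral\<^sup>N M (d n)) = 0"
    by (simp add: lim_imp_Liminf)
  \<comment> \<open>Fatou controls only the lower limit. That is enough: wherever the series of real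
    numbers converges, \<open>d n \<omega>\<close> converges as well, and its limit must be this
    lower limit.\<close>
  then have "(\<integral>\<^sup>+\<omega>. liminf (\<lambda>n. d n \<omega>) \<partial>M) = 0"
    using nn_integral_liminf[of d M] by simp
  then have "AE \<omega> in M. liminf (\<lambda>n. d n \<omega>) = 0"
    by (subst (asm) nn_integral_0_iff_AE) auto
  moreover have "AE \<omega> in M. \<forall>n. \<eta> (h - s n) \<omega> = \<eta> h \<omega> - (\<Sum>i<n. a i * \<eta> (f i) \<omega>)"
    unfolding AE_all_countable
  proof
    fix n
    show "AE \<omega> in M. \<eta> (h - s n) \<omega> = \<eta> h \<omega> - (\<Sum>i<n. a i * \<eta> (f i) \<omega>)"
      using white_noise_add[OF wn, of h "-1" "s n"] white_noise_sum[OF wn, where a = a and f = f and n = n]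
      by eventually_elim (simp add: s_def)
  qed
  ultimately show ?thesis
  proof eventually_elim
    case (elim \<omega>)
    show ?case
    proof (intro allI impI)
      fix l
      assume l: "(\<lambda>i. a i * \<eta> (f i) \<omega>) sums l"
      have "(\<lambda>n. d n \<omega>) \<longlonglongrightarrow> ennreal ((\<eta> h \<omega> - l)\<^sup>2)"
        using l elim(2) unfolding sums_def d_def by (intro tendsto_ennrealI) (auto intro!: tendsto_intros)
      then have "ennreal ((\<eta> h \<omega> - l)\<^sup>2) = 0"
        using elim(1) by (simp add: lim_imp_Liminf)
      then show "\<eta> h \<omega> = l" by simp
    qed
  qed
qed

text \<open>Square summable weights make the operator with singular values \<open>k\<close> Hilbert-Schmidt.\<close>

lemma (in hilbert_basis) white_noise_image:
  assumes "prob_space M" and wn: "white_noise M \<gamma> \<eta>" and "\<gamma> > 0"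
    and f: "orthonormal_seq f" and k: "summable (\<lambda>i. (k i)\<^sup>2)"
    and h: "\<And>x. (\<lambda>i. (k i * (x \<bullet> E i)) *\<^sub>R f i) sums h x"
  obtains W where "W \<in> borel_measurable M" "\<And>x. AE \<omega> in M. W \<omega> \<bullet> x = \<eta> (h x) \<omega>"
proof -
  note [measurable] = white_noise_measurable[OF wn]
  have nf: "(norm (f i))\<^sup>2 = 1" for i
    by (simp add: power2_norm_eq_inner orthonormal_seq_inner[OF f])
  \<comment> \<open>The expected sum of squares is \<gamma>^2 times the squared Hilbert-Schmidt
    norm; being finite, it forces almost sure square summability of the coordinates.\<close>
  have "(\<integral>\<^sup>+\<omega>. (\<Sum>i. ennreal ((k i * \<eta> (f i) \<omega>)\<^sup>2)) \<partial>M)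
      = (\<Sum>i. \<integral>\<^sup>+\<omega>. ennreal ((k i)\<^sup>2) * ennreal ((\<eta> (f i) \<omega>)\<^sup>2) \<partial>M)"
    by (subst nn_integral_suminf) (auto simp: ennreal_mult power_mult_distrib)
  also have "\<dots> = (\<Sum>i. ennreal ((k i)\<^sup>2 * \<gamma>\<^sup>2))"
    by (simp add: nn_integral_cmult white_noise_second_moment[OF assms(1-3)] ennreal_mult nf)
  also have "\<dots> = ennreal (\<Sum>i. (k i)\<^sup>2 * \<gamma>\<^sup>2)"
    using k by (intro suminf_ennreal2 summable_mult2) auto
  finally have "AE \<omega> in M. (\<Sum>i. ennreal ((k i * \<eta> (f i) \<omega>)\<^sup>2)) \<noteq> \<infinity>"
    by (intro nn_integral_noteq_infinite) auto
  then have "AE \<omega> in M. summable (\<lambda>i. (k i * \<eta> (f i) \<omega>)\<^sup>2)"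
    by eventually_elim (auto intro: summable_suminf_not_top)
  then obtain N where sm: "\<And>\<omega>. \<omega> \<in> space M - N \<Longrightarrow> summable (\<lambda>i. (k i * \<eta> (f i) \<omega>)\<^sup>2)"
    and N: "N \<in> null_sets M"
    by (rule AE_E3) blast
  have [measurable]: "N \<in> sets M"
    using N by auto
  \<comment> \<open>On the null set \<open>N\<close>, where the series may diverge, the value 0
    keeps every coordinate measurable on the whole space.\<close>
  define W where "W \<omega> = (if \<omega> \<in> N then 0 else (\<Sum>i. (k i * \<eta> (f i) \<omega>) *\<^sub>R E i))" for \<omega>
  have W: "(\<lambda>i. (k i * \<eta> (f i) \<omega>) *\<^sub>R E i) sums W \<omega>" if "\<omega> \<in> space M - N" for \<omega>
    using orthonormal_seq_summable[OF ortho sm[OF that]] that by (simp add: W_def summable_sums)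
  show thesis
  proof
    show "W \<in> borel_measurable M"
    proof (rule borel_measurable_coords)
      fix i
      have "(\<lambda>\<omega>. if \<omega> \<in> N then 0 else k i * \<eta> (f i) \<omega>) \<in> borel_measurable M"
        by measurable
      moreover have "W \<omega> \<bullet> E i = (if \<omega> \<in> N then 0 else k i * \<eta> (f i) \<omega>)" if "\<omega> \<in> space M" for \<omega>
        using orthonormal_seq_sums_inner[OF ortho W, of \<omega> i] that by (auto simp: W_def)
      ultimately show "(\<lambda>\<omega>. W \<omega> \<bullet> E i) \<in> borel_measurable M"
        by (subst measurable_cong) auto
    qed
    \<comment> \<open>Pairing the series of \<open>W\<close> with \<open>x\<close> gives the scalar
      series that \<open>white_noise_sums\<close> identifies with \<open>\<eta> (h x)\<close>; its
      convergence comes from that of \<open>W\<close>.\<close>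
    show "AE \<omega> in M. W \<omega> \<bullet> x = \<eta> (h x) \<omega>" for x
      using white_noise_sums[OF assms(1-3) h[of x]] AE_not_in[OF N] AE_space
    proof eventually_elim
      case (elim \<omega>)
      then have "(\<lambda>i. (k i * (x \<bullet> E i)) * \<eta> (f i) \<omega>) sums (W \<omega> \<bullet> x)"
        using sums_inner_left[OF W, of \<omega> x] by (simp add: inner_commute mult_ac)
      with elim(1) show ?case by auto
    qed
  qed
qed

section \<open>Bias and variance sums\<close>

text \<open>With z = t * x^(-s), the exponent \<beta>/s lies in [0,1], hence z^(\<beta>/s) \<le> 1 +
  z; this is where the smoothness is capped. The lower bound on \<open>l\<close> turns 1 + z into at
  most c^2 * (1 + t * l), and squaring yields c^4. In the application \<open>x\<close> is the index,
  so x^(2\<beta>) is the weight of the source condition.\<close>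

lemma bias_factor_le:
  fixes x t l c s \<beta> :: real
  assumes "x > 0" "t > 0" "c \<ge> 1" "s > 0" "0 \<le> \<beta>" "\<beta> \<le> s"
    and l: "l \<ge> (inverse c)\<^sup>2 * x powr (- s)"
  shows "(1 / (1 + t * l))\<^sup>2 \<le> c ^ 4 * t powr (- (2 * \<beta> / s)) * x powr (2 * \<beta>)"
proof -
  define z where "z = t * x powr (- s)"
  have z: "z > 0"
    using assms by (simp add: z_def)
  have c2: "c\<^sup>2 \<ge> 1"
    using \<open>c \<ge> 1\<close> by simp
  have "z powr (\<beta> / s) \<le> 1 + z"
  proof (cases "z \<le> 1")
    case True
    then have "z powr (\<beta> / s) \<le> 1"
      using z assms by (intro powr_le1) auto
    then show ?thesis using z by simp
  next
    case False
    then have "z powr (\<beta> / s) \<le> z powr 1"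
      using assms by (intro powr_mono) auto
    then show ?thesis using z by simp
  qed
  also have "\<dots> \<le> c\<^sup>2 * (1 + t * l)"
  proof -
    have "z \<le> c\<^sup>2 * (t * l)"
      using mult_left_mono[OF l, of "c\<^sup>2 * t"] assms by (simp add: z_def field_simps)
    then show ?thesis using c2 by (simp add: distrib_left)
  qed
  finally have "z powr (\<beta> / s) \<le> c\<^sup>2 * (1 + t * l)" .
  moreover have tl: "1 + t * l > 0"
  proof -
    have "0 \<le> (inverse c)\<^sup>2 * x powr (- s)"
      by simp
    with l have "0 \<le> l" by linarith
    then show ?thesis using \<open>t > 0\<close> by (simp add: add_pos_nonneg)
  qed
  moreover have zpos: "z powr (\<beta> / s) > 0"
    using z by simp
  ultimately have "1 / (1 + t * l) \<le> c\<^sup>2 / z powr (\<beta> / s)"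
    by (simp add: field_simps)
  then have "(1 / (1 + t * l))\<^sup>2 \<le> (c\<^sup>2 / z powr (\<beta> / s))\<^sup>2"
    using tl by (intro power_mono) auto
  also have "\<dots> = c ^ 4 * (z powr (\<beta> / s)) powr (- 2)"
    using zpos by (simp add: power_divide powr_minus powr_numeral divide_inverse[of "_ ^ 4"] flip: power_mult)
  also have "(z powr (\<beta> / s)) powr (- 2) = t powr (- (2 * \<beta> / s)) * x powr (2 * \<beta>)"
    using assms by (simp add: z_def powr_mult powr_powr mult.commute[of _ 2])
  finally show ?thesis by (simp add: mult_ac)
qed

text \<open>A discrete integral test: ln (1 + 1/x) \<ge> 1/(x+1) and exp y \<ge> 1 + y give
  ((x+1)/x)^q \<ge> 1 + q/(x+1), which is multiplied by (x+1)^(-q). The right-hand side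
  telescopes.\<close>

lemma powr_step_le:
  fixes x q :: real
  assumes "x > 0" "q > 0"
  shows "q * (x + 1) powr (- 1 - q) \<le> x powr (- q) - (x + 1) powr (- q)"
proof -
  have "1 / (x + 1) \<le> ln ((x + 1) / x)"
    using ln_le_minus_one[of "x / (x + 1)"] assms by (simp add: ln_div field_simps)
  then have "1 + q * (1 / (x + 1)) \<le> 1 + q * ln ((x + 1) / x)"
    using assms by (intro add_left_mono mult_left_mono) auto
  also have "\<dots> \<le> exp (q * ln ((x + 1) / x))"
    by (rule exp_ge_add_one_self)
  also have "\<dots> = ((x + 1) / x) powr q"
    using assms by (simp add: powr_def)
  finally have "(x + 1) powr (- q) * (1 + q * (1 / (x + 1))) \<le> (x + 1) powr (- q) * ((x + 1) / x) powr q"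
    by (intro mult_left_mono) auto
  also have "\<dots> = x powr (- q)"
    using assms by (simp add: powr_divide powr_minus field_simps)
  also have "(x + 1) powr (- q) * (1 + q * (1 / (x + 1))) = (x + 1) powr (- q) + q * (x + 1) powr (- 1 - q)"
    using assms powr_add[of "x + 1" "- 1" "- q"] by (simp add: powr_minus_divide distrib_left distrib_right)
  finally show ?thesis by simp
qed

text \<open>The telescoping bound covers the terms after the first, with total at most m^(-q)/q. The
  first term is kept apart and bounded by m^(-q), whence the constant 1 + 1/q.\<close>

lemma powr_tail_sum_le:
  fixes q :: real
  assumes "q > 0" "m \<ge> 1"
  shows "(\<Sum>j=m..N. real j powr (- 1 - q)) \<le> (1 + 1 / q) * real m powr (- q)"
proof (cases "m \<le> N")
  case False
  then show ?thesis using assms by simp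
next
  case True
  have "(\<Sum>j=m..N. real j powr (- 1 - q))
      \<le> real m powr (- 1 - q) + (real m powr (- q) - real N powr (- q)) / q"
    using True
  proof (induction N rule: dec_induct)
    case base
    then show ?case by simp
  next
    case (step n)
    have "real (Suc n) powr (- 1 - q) \<le> (real n powr (- q) - real (Suc n) powr (- q)) / q"
      using powr_step_le[of "real n" q] step assms by (simp add: field_simps add.commute)
    with step show ?case by (simp add: diff_divide_distrib)
  qed
  also have "\<dots> \<le> real m powr (- q) + real m powr (- q) / q"
    using assms by (intro add_mono divide_right_mono powr_mono) auto
  finally show ?thesis by (simp add: distrib_right)
qed

text \<open>Two bounds on the filter factor compete: \<open>r i\<close> \<le> 1 /
  \<open>k i\<close>, where the data dominate, and \<open>r i\<close> \<le> t * \<open>l i\<close> *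
  \<open>k i\<close>, where the prior dominates. They cross at the order of T = t^(1/s). The head
  has at most T terms of size c^2 * T^(2p). In the tail the squared bound decays like i^(-1-q), and
  2s - q = 1 + 2p makes both parts of order T^(1+2p); the constant is 1 + (1 + 1/q).\<close>

lemma variance_sum_le:
  fixes c p \<epsilon> t :: real and k :: "nat \<Rightarrow> real"
  assumes "\<epsilon> > 0" "p > 0" "c \<ge> 1" "t > 0"
    and k: "\<And>i. i \<ge> 1 \<Longrightarrow> inverse c * real i powr (- p) \<le> k i \<and> k i \<le> c * real i powr (- p)"
  defines "l \<equiv> \<lambda>i. real i powr (- 1 - 2 * \<epsilon>)"
  defines "r \<equiv> \<lambda>i. t * l i * k i / (1 + t * l i * (k i)\<^sup>2)"
  shows "(\<Sum>i<n. (r (Suc i))\<^sup>2)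
    \<le> c\<^sup>2 * (2 + 1 / (1 + 4 * \<epsilon> + 2 * p)) * t powr ((1 + 2 * p) / (1 + 2 * \<epsilon> + 2 * p))"
proof -
  define s where "s = 1 + 2 * \<epsilon> + 2 * p"
  define q where "q = 1 + 4 * \<epsilon> + 2 * p"
  define T where "T = t powr (1 / s)"
  \<comment> \<open>The first index above \<open>T\<close>: the head has \<open>m - 1\<close> \<le>
    \<open>T\<close> terms, and \<open>m\<close> \<ge> 1 also when \<open>T\<close> < 1 and the head
    is empty.\<close>
  define m where "m = nat \<lfloor>T\<rfloor> + 1"
  have s: "s > 0" and q: "q > 0" and T: "T > 0"
    using assms by (auto simp: s_def q_def T_def)
  have t: "t = T powr s"
    using assms s by (simp add: T_def powr_powr)
  have kpos: "k i > 0" if "i \<ge> 1" for i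
  proof -
    have "0 < inverse c * real i powr (- p)"
      using assms that by simp
    with k[OF that] show ?thesis by linarith
  qed
  have lpos: "l i > 0" if "i \<ge> 1" for i
    using that by (simp add: l_def)
  have head: "(r i)\<^sup>2 \<le> c\<^sup>2 * T powr (2 * p)" if "i \<ge> 1" "real i \<le> T" for i
  proof -
    have "r i \<le> inverse (k i)"
      using kpos[OF that(1)] lpos[OF that(1)] assms(4)
      by (simp add: r_def field_simps power2_eq_square add_pos_pos)
    also have "\<dots> \<le> inverse (inverse c * real i powr (- p))"
      using k[OF that(1)] that assms by (intro le_imp_inverse_le) auto
    also have "\<dots> = c * real i powr p"
      by (simp add: powr_minus)
    also have "\<dots> \<le> c * T powr p"
      using that assms by (intro mult_left_mono powr_mono2) auto
    finally have "(r i)\<^sup>2 \<le> (c * T powr p)\<^sup>2"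
      using kpos[OF that(1)] lpos[OF that(1)] assms(4)
      by (intro power_mono) (auto simp: r_def intro!: divide_nonneg_nonneg add_nonneg_nonneg)
    also have "\<dots> = c\<^sup>2 * T powr (2 * p)"
      using T by (simp add: power_mult_distrib powr_power mult.commute)
    finally show ?thesis .
  qed
  have tail: "(r i)\<^sup>2 \<le> c\<^sup>2 * T powr (2 * s) * real i powr (- 1 - q)" if "i \<ge> 1" for i
  proof -
    have "r i \<le> t * l i * k i"
      using kpos[OF that] lpos[OF that] assms(4)
      unfolding r_def by (intro divide_le_eq_1 [THEN iffD2] mult_imp_div_pos_le)
        (auto intro: add_pos_nonneg)
    also have "\<dots> \<le> t * l i * (c * real i powr (- p))"
      using k[OF that] lpos[OF that] assms(4) by (intro mult_left_mono) auto
    also have "\<dots> = c * t * real i powr (- 1 - 2 * \<epsilon> - p)"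
      by (simp add: l_def powr_diff powr_minus divide_inverse)
    finally have "(r i)\<^sup>2 \<le> (c * t * real i powr (- 1 - 2 * \<epsilon> - p))\<^sup>2"
      using kpos[OF that] lpos[OF that] assms(4)
      by (intro power_mono) (auto simp: r_def intro!: divide_nonneg_nonneg add_nonneg_nonneg)
    also have "\<dots> = c\<^sup>2 * T powr (2 * s) * real i powr (- 1 - q)"
      using T that by (simp add: power_mult_distrib powr_power t q_def algebra_simps)
    finally show ?thesis .
  qed
  have "(\<Sum>i<n. (r (Suc i))\<^sup>2) = (\<Sum>i=1..n. (r i)\<^sup>2)"
    by (rule sum.reindex_bij_witness[of _ "\<lambda>i. i - 1" Suc]) auto
  \<comment> \<open>Only an inequality, since the head may reach beyond \<open>n\<close>.\<close>
  also have "\<dots> \<le> (\<Sum>i\<in>{1..m - 1} \<union> {m..n}. (r i)\<^sup>2)"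
    by (rule sum_mono2) (auto simp: m_def)
  also have "\<dots> = (\<Sum>i=1..m - 1. (r i)\<^sup>2) + (\<Sum>i=m..n. (r i)\<^sup>2)"
    by (rule sum.union_disjoint) (auto simp: m_def)
  also have "(\<Sum>i=1..m - 1. (r i)\<^sup>2) \<le> (\<Sum>i=1..m - 1. c\<^sup>2 * T powr (2 * p))"
  proof (intro sum_mono head)
    fix i assume "i \<in> {1..m - 1}"
    then show "real i \<le> T"
      using T by (simp add: m_def) linarith
  qed auto
  also have "\<dots> \<le> T * (c\<^sup>2 * T powr (2 * p))"
    using T by (auto simp: m_def intro!: mult_right_mono)
  also have "\<dots> = c\<^sup>2 * T powr (1 + 2 * p)"
    using T by (simp add: powr_add)
  also have "(\<Sum>i=m..n. (r i)\<^sup>2) \<le> (\<Sum>i=m..n. c\<^sup>2 * T powr (2 * s) * real i powr (- 1 - q))"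
    by (intro sum_mono tail) (auto simp: m_def)
  also have "\<dots> \<le> c\<^sup>2 * T powr (2 * s) * ((1 + 1 / q) * real m powr (- q))"
    unfolding sum_distrib_left[symmetric] using q
    by (intro mult_left_mono powr_tail_sum_le) (auto simp: m_def)
  also have "\<dots> \<le> c\<^sup>2 * T powr (2 * s) * ((1 + 1 / q) * T powr (- q))"
  proof (intro mult_left_mono powr_mono2')
    show "T \<le> real m"
      using T by (simp add: m_def) linarith
  qed (use q T in auto)
  also have "\<dots> = c\<^sup>2 * (1 + 1 / q) * (T powr (2 * s) * T powr (- q))"
    by (simp add: mult_ac)
  also have "T powr (2 * s) * T powr (- q) = T powr (1 + 2 * p)"
    by (simp add: s_def q_def flip: powr_add)
  also have "c\<^sup>2 * T powr (1 + 2 * p) + c\<^sup>2 * (1 + 1 / q) * T powr (1 + 2 * p)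
      = c\<^sup>2 * (2 + 1 / q) * T powr (1 + 2 * p)"
    by (simp add: algebra_simps)
  also have "T powr (1 + 2 * p) = t powr ((1 + 2 * p) / s)"
    by (simp add: T_def powr_powr)
  finally show ?thesis
    by (simp add: s_def q_def)
qed

section \<open>The Kalman filter in the singular basis\<close>

locale singular_system = hilbert_basis E
  for E :: "nat \<Rightarrow> 'x::{real_inner, complete_space}" +
  fixes A :: "'x \<Rightarrow> 'y::{real_inner, complete_space}" and \<kappa> :: "nat \<Rightarrow> real"
  assumes A: "bounded_linear A"
    and \<kappa>_pos: "\<And>i. \<kappa> i > 0"
    and adjoint_A_A: "\<And>i. adjoint A (A (E i)) = (\<kappa> i)\<^sup>2 *\<^sub>R E i"
begin

definition F :: "nat \<Rightarrow> 'y" where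
  "F i = inverse (\<kappa> i) *\<^sub>R A (E i)"

lemma adjoint_coord: "adjoint A y \<bullet> E i = \<kappa> i * (y \<bullet> F i)"
  using adjoint_works_hilbert[OF A, of "E i" y] \<kappa>_pos[of i] by (simp add: F_def inner_commute)

lemma A_coord: "A x \<bullet> F i = \<kappa> i * (x \<bullet> E i)"
  using adjoint_works_hilbert[OF A, of x "A (E i)"] \<kappa>_pos[of i]
  by (simp add: F_def adjoint_A_A power2_eq_square)

lemma ortho_F: "orthonormal_seq F"
proof -
  have "F i \<bullet> F j = (if i = j then 1 else 0)" for i j
    using A_coord[of "E i" j] \<kappa>_pos[of i]
    by (auto simp: F_def[of i] orthonormal_seq_inner[OF ortho])
  then show ?thesis by (simp add: orthonormal_seq_def)
qed

text \<open>The operator under \<open>inv\<close> acts on the data space, where no complete system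
  is given. So a preimage of \<open>y\<close> is exhibited, after which the one picked by
  \<open>inv\<close> is a preimage as well. The equation fixes its coordinates along
  \<open>F\<close>, and \<open>C\<close> after the adjoint sees nothing else.\<close>

lemma kalman_gain_coord:
  assumes C: "\<And>x i. C x \<bullet> E i = d i * (x \<bullet> E i)"
    and d: "\<And>i. d i \<ge> 0" and "\<gamma> > 0"
    and k: "\<And>i. k i = d i * \<kappa> i / ((\<kappa> i)\<^sup>2 * d i + \<gamma>\<^sup>2)"
    and sk: "summable (\<lambda>i. (k i)\<^sup>2)"
  shows "kalman_gain A \<gamma> C y \<bullet> E i = k i * (y \<bullet> F i)"
proof -
  interpret A: bounded_linear A by (rule A)
  define T where "T v = A (C (adjoint A v)) + \<gamma>\<^sup>2 *\<^sub>R v" for v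
  have pos: "(\<kappa> i)\<^sup>2 * d i + \<gamma>\<^sup>2 > 0" for i
    using d[of i] \<open>\<gamma> > 0\<close> by (intro add_nonneg_pos) auto
  obtain w where w: "\<And>i. w \<bullet> E i = k i * (y \<bullet> F i)"
    using exists_coords[OF bessel_summable_mult[OF ortho_F sk]] by blast
  \<comment> \<open>Found by solving backwards: if the gain maps \<open>y\<close> to
    \<open>w\<close>, the equation for the preimage reads A w + \<gamma>^2 x = y.\<close>
  define x where "x = (inverse (\<gamma>\<^sup>2)) *\<^sub>R (y - A w)"
  have "C (adjoint A x) = w"
  proof (rule coord_eqI)
    fix i
    have "C (adjoint A x) \<bullet> E i = d i * \<kappa> i * (inverse (\<gamma>\<^sup>2) * (y \<bullet> F i - \<kappa> i * (k i * (y \<bullet> F i))))"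
      by (simp add: C adjoint_coord x_def inner_diff_left A_coord w)
    also have "\<dots> = k i * (y \<bullet> F i)"
    proof -
      have "d i * \<kappa> i * (inverse (\<gamma>\<^sup>2) * (1 - \<kappa> i * k i)) = k i"
        using pos[of i] \<open>\<gamma> > 0\<close> unfolding k by (simp add: divide_simps) (simp add: algebra_simps power2_eq_square)
      moreover have "d i * \<kappa> i * (inverse (\<gamma>\<^sup>2) * (y \<bullet> F i - \<kappa> i * (k i * (y \<bullet> F i))))
          = d i * \<kappa> i * (inverse (\<gamma>\<^sup>2) * (1 - \<kappa> i * k i)) * (y \<bullet> F i)"
        by (simp add: algebra_simps)
      ultimately show ?thesis by simp
    qed
    finally show "C (adjoint A x) \<bullet> E i = w \<bullet> E i" by (simp add: w)
  qed
  then have "T x = y"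
    using \<open>\<gamma> > 0\<close> by (simp add: T_def x_def)
  then have T: "T (inv T y) = y"
    by (metis f_inv_into_f rangeI)
  define v where "v = inv T y"
  have "y \<bullet> F i = ((\<kappa> i)\<^sup>2 * d i + \<gamma>\<^sup>2) * (v \<bullet> F i)"
  proof -
    have "y \<bullet> F i = T v \<bullet> F i"
      by (simp add: v_def T)
    then show ?thesis
      by (simp add: T_def inner_add_left A_coord C adjoint_coord algebra_simps power2_eq_square)
  qed
  moreover have "kalman_gain A \<gamma> C y = C (adjoint A v)"
    by (simp add: kalman_gain_def v_def T_def[abs_def])
  ultimately show ?thesis
    using pos[of i] by (simp add: C adjoint_coord k)
qed

end

section \<open>Recursions for covariance, gain and mean in coordinates\<close>

locale kalman_filter = singular_system E A \<kappa>
  for E :: "nat \<Rightarrow> 'x::{real_inner, complete_space}"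
    and A :: "'x \<Rightarrow> 'y::{real_inner, complete_space}" and \<kappa> +
  fixes S :: "'x \<Rightarrow> 'x" and \<mu> :: "nat \<Rightarrow> real" and \<alpha> \<gamma> :: real
  assumes S: "bounded_linear S" "\<And>i. S (E i) = \<mu> i *\<^sub>R E i"
    and \<mu>_pos: "\<And>i. \<mu> i > 0" and \<alpha>_pos: "\<alpha> > 0" and \<gamma>_pos: "\<gamma> > 0"
    and hilbert_schmidt: "summable (\<lambda>i. (\<mu> i * \<kappa> i)\<^sup>2)"
begin

abbreviation "cov \<equiv> kalman_cov A \<gamma> (\<lambda>x. (\<gamma>\<^sup>2 / \<alpha>) *\<^sub>R S x)"

text \<open>The posterior precision in direction i is \<open>den n i\<close> / (\<gamma>^2 *
  \<open>\<mu> i\<close>); each observation adds \<open>(\<kappa> i)\<^sup>2\<close> / \<gamma>^2 to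
  it, hence the linear growth in \<open>n\<close>.\<close>

definition den :: "nat \<Rightarrow> nat \<Rightarrow> real" where
  "den n i = \<alpha> + real n * \<mu> i * (\<kappa> i)\<^sup>2"

text \<open>The singular values of the gain computed from \<open>cov n\<close>, that is, of the gain
  used in step n + 1; this explains \<open>Suc n\<close> in the denominator.\<close>

definition gain :: "nat \<Rightarrow> nat \<Rightarrow> real" where
  "gain n i = \<mu> i * \<kappa> i / den (Suc n) i"

lemma den_ge: "den n i \<ge> \<alpha>"
  using \<mu>_pos[of i] by (simp add: den_def)

lemma den_pos: "den n i > 0"
  using den_ge[of n i] \<alpha>_pos by linarith

lemma den_Suc: "den (Suc n) i = den n i + \<mu> i * (\<kappa> i)\<^sup>2"
  by (simp add: den_def algebra_simps)

lemma one_minus_gain: "1 - gain n i * \<kappa> i = den n i / den (Suc n) i"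
  using den_pos[of "Suc n" i] den_pos[of n i]
  by (simp add: gain_def den_Suc field_simps power2_eq_square)

lemma summable_gain: "summable (\<lambda>i. (gain n i)\<^sup>2)"
proof (rule summable_comparison_test_ev)
  have "(gain n i)\<^sup>2 \<le> (\<mu> i * \<kappa> i / \<alpha>)\<^sup>2" for i
    using \<mu>_pos[of i] \<kappa>_pos[of i] \<alpha>_pos den_ge[of "Suc n" i] den_pos[of "Suc n" i]
    unfolding gain_def by (intro power_mono divide_left_mono) auto
  then show "\<forall>\<^sub>F i in sequentially. norm ((gain n i)\<^sup>2) \<le> (\<mu> i * \<kappa> i)\<^sup>2 * inverse (\<alpha>\<^sup>2)"
    by (simp add: power_divide divide_inverse power_mult_distrib power_inverse)
  show "summable (\<lambda>i. (\<mu> i * \<kappa> i)\<^sup>2 * inverse (\<alpha>\<^sup>2))"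
    by (rule summable_mult2[OF hilbert_schmidt])
qed

text \<open>Covariance and gain determine each other alternately. The premise is the induction
  hypothesis of \<open>cov_coord\<close>, whose induction step needs this formula;
  \<open>gain_coord\<close> discharges it afterwards.\<close>

lemma gain_eq:
  assumes "\<And>x i. cov n x \<bullet> E i = \<gamma>\<^sup>2 * \<mu> i / den n i * (x \<bullet> E i)"
  shows "kalman_gain A \<gamma> (cov n) y \<bullet> E i = gain n i * (y \<bullet> F i)"
proof (rule kalman_gain_coord[OF assms _ \<gamma>_pos _ summable_gain])
  fix i
  show "0 \<le> \<gamma>\<^sup>2 * \<mu> i / den n i"
    using \<mu>_pos[of i] den_pos[of n i] by simp
  have "(\<kappa> i)\<^sup>2 * (\<gamma>\<^sup>2 * \<mu> i / den n i) + \<gamma>\<^sup>2 = \<gamma>\<^sup>2 * den (Suc n) i / den n i"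
    using den_pos[of n i] by (simp add: den_Suc field_simps)
  then show "gain n i = \<gamma>\<^sup>2 * \<mu> i / den n i * \<kappa> i / ((\<kappa> i)\<^sup>2 * (\<gamma>\<^sup>2 * \<mu> i / den n i) + \<gamma>\<^sup>2)"
    using \<gamma>_pos den_pos[of n i] by (simp add: gain_def)
qed

lemma cov_coord: "cov n x \<bullet> E i = \<gamma>\<^sup>2 * \<mu> i / den n i * (x \<bullet> E i)"
proof (induction n arbitrary: x i)
  case 0
  then show ?case
    by (simp add: bounded_linear_diagonal[OF S] den_def)
next
  case (Suc n)
  have "cov (Suc n) x \<bullet> E i = (1 - gain n i * \<kappa> i) * (cov n x \<bullet> E i)"
    by (simp add: inner_diff_left gain_eq[OF Suc.IH] A_coord left_diff_distrib)
  also have "\<dots> = (1 - gain n i * \<kappa> i) * (\<gamma>\<^sup>2 * \<mu> i / den n i) * (x \<bullet> E i)"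
    by (simp add: Suc.IH)
  finally show ?case
    using den_pos[of n i] by (simp add: one_minus_gain)
qed

lemma gain_coord: "kalman_gain A \<gamma> (cov n) y \<bullet> E i = gain n i * (y \<bullet> F i)"
  by (rule gain_eq[OF cov_coord])

text \<open>The domain of the gain carries no complete system, so
  \<open>adjoint_works_hilbert\<close> does not apply. The transposed diagonal series is verified by
  Parseval in \<open>'x\<close> and identified by uniqueness of adjoints; it has the form required
  by \<open>white_noise_image\<close>.\<close>

lemma gain_adjoint:
  "kalman_gain A \<gamma> (cov n) y \<bullet> x = y \<bullet> adjoint (kalman_gain A \<gamma> (cov n)) x"
  "(\<lambda>i. (gain n i * (x \<bullet> E i)) *\<^sub>R F i) sums adjoint (kalman_gain A \<gamma> (cov n)) x"
proof -
  define h where "h x = (\<Sum>i. (gain n i * (x \<bullet> E i)) *\<^sub>R F i)" for x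
  have h: "(\<lambda>i. (gain n i * (x \<bullet> E i)) *\<^sub>R F i) sums h x" for x
    unfolding h_def
    by (intro summable_sums orthonormal_seq_summable[OF ortho_F]
        bessel_summable_mult[OF ortho summable_gain])
  have "kalman_gain A \<gamma> (cov n) y \<bullet> x = y \<bullet> h x" for y x
  proof (rule sums_unique2)
    show "(\<lambda>i. gain n i * (y \<bullet> F i) * (x \<bullet> E i)) sums (kalman_gain A \<gamma> (cov n) y \<bullet> x)"
      using parseval_inner[of "kalman_gain A \<gamma> (cov n) y" x] by (simp add: gain_coord)
    show "(\<lambda>i. gain n i * (y \<bullet> F i) * (x \<bullet> E i)) sums (y \<bullet> h x)"
      using sums_inner_right[OF h, of y x] by (simp add: mult_ac)
  qed
  moreover from this have "adjoint (kalman_gain A \<gamma> (cov n)) = h"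
    by (intro adjoint_unique) simp
  ultimately show
    "kalman_gain A \<gamma> (cov n) y \<bullet> x = y \<bullet> adjoint (kalman_gain A \<gamma> (cov n)) x"
    "(\<lambda>i. (gain n i * (x \<bullet> E i)) *\<^sub>R F i) sums adjoint (kalman_gain A \<gamma> (cov n)) x"
    using h by auto
qed

text \<open>The residual splits into the genuine vector \<open>A (u - m \<omega>)\<close> and the
  white noise, and the gain is applied to each separately. The mean \<open>m\<close> is an arbitrary
  measurable function, because it depends on the same draw as the data.\<close>

lemma apply_gain:
  fixes u :: 'x and n j :: nat
  assumes "prob_space M" and wn: "white_noise M \<gamma> \<eta>" and m: "m \<in> borel_measurable M"
  defines "Z \<equiv> apply_operator M (kalman_gain A \<gamma> (cov n))
    (\<lambda>h \<omega>. single_draw_data A u \<eta> j h \<omega> - A (m \<omega>) \<bullet> h)"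
  shows "Z \<in> borel_measurable M"
    and "AE \<omega> in M. Z \<omega> \<bullet> E i = gain n i * (\<kappa> i * (u \<bullet> E i - m \<omega> \<bullet> E i) + \<eta> (F i) \<omega>)"
proof -
  interpret A: bounded_linear A by (rule A)
  define K where "K = kalman_gain A \<gamma> (cov n)"
  define g where "g h \<omega> = A (u - m \<omega>) \<bullet> h + \<eta> h \<omega>" for h \<omega>
  have g: "g = (\<lambda>h \<omega>. single_draw_data A u \<eta> j h \<omega> - A (m \<omega>) \<bullet> h)"
    by (simp add: fun_eq_iff g_def single_draw_data_def A.diff inner_diff_left)
  obtain W where W: "W \<in> borel_measurable M"
    and WE: "\<And>x. AE \<omega> in M. W \<omega> \<bullet> x = \<eta> (adjoint K x) \<omega>"
    using white_noise_image[OF assms(1,2) \<gamma>_pos ortho_F summable_gain gain_adjoint(2)]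
    unfolding K_def by blast
  \<comment> \<open>A witness for the choice in \<open>apply_operator\<close>; the chosen
    \<open>Z\<close> then inherits the pairings.\<close>
  define Z' where "Z' \<omega> = K (A (u - m \<omega>)) + W \<omega>" for \<omega>
  have "Z' \<in> borel_measurable M"
  proof (rule borel_measurable_coords)
    fix i
    have "(\<lambda>\<omega>. gain n i * (\<kappa> i * (u \<bullet> E i - m \<omega> \<bullet> E i)) + W \<omega> \<bullet> E i) \<in> borel_measurable M"
      using borel_measurable_inner_left[OF m, of "E i"] borel_measurable_inner_left[OF W, of "E i"]
      by measurable
    then show "(\<lambda>\<omega>. Z' \<omega> \<bullet> E i) \<in> borel_measurable M"
      by (simp add: Z'_def K_def inner_add_left gain_coord A_coord inner_diff_left)
  qed
  moreover have "AE \<omega> in M. Z' \<omega> \<bullet> x = g (adjoint K x) \<omega>" for x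
    using WE[of x]
    by eventually_elim (simp add: Z'_def g_def inner_add_left gain_adjoint(1)[of n _ x, folded K_def])
  ultimately have ex: "\<exists>Z. Z \<in> borel_measurable M \<and> (\<forall>x. AE \<omega> in M. Z \<omega> \<bullet> x = g (adjoint K x) \<omega>)"
    by blast
  have Z: "Z \<in> borel_measurable M \<and> (\<forall>x. AE \<omega> in M. Z \<omega> \<bullet> x = g (adjoint K x) \<omega>)"
    using someI_ex[OF ex] by (simp add: Z_def apply_operator_def K_def g)
  then show "Z \<in> borel_measurable M" by blast
  have "(\<lambda>j. (gain n j * (E i \<bullet> E j)) *\<^sub>R F j) sums (gain n i *\<^sub>R F i)"
    using sums_single[of i "\<lambda>j. gain n j *\<^sub>R F j"]
    by (rule back_subst[where P = "\<lambda>f. f sums _"])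
      (auto simp: fun_eq_iff orthonormal_seq_inner[OF ortho])
  then have KE: "adjoint K (E i) = gain n i *\<^sub>R F i"
    using gain_adjoint(2)[of n "E i"] sums_unique2 unfolding K_def by blast
  have "AE \<omega> in M. Z \<omega> \<bullet> E i = g (gain n i *\<^sub>R F i) \<omega>"
    using Z KE by metis
  with white_noise_scaleR[OF wn, of "gain n i" "F i"]
  show "AE \<omega> in M. Z \<omega> \<bullet> E i = gain n i * (\<kappa> i * (u \<bullet> E i - m \<omega> \<bullet> E i) + \<eta> (F i) \<omega>)"
    by eventually_elim (simp add: g_def A_coord inner_diff_left algebra_simps)
qed

text \<open>Measurability is carried through the induction because \<open>apply_gain\<close> asks
  for it at every step.\<close>

lemma mean_coord:
  fixes u :: 'x
  assumes "prob_space M" and wn: "white_noise M \<gamma> \<eta>"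
  defines "m \<equiv> kalman_mean M A \<gamma> (\<lambda>x. (\<gamma>\<^sup>2 / \<alpha>) *\<^sub>R S x) 0 (single_draw_data A u \<eta>)"
  shows "m n \<in> borel_measurable M"
    and "AE \<omega> in M. m n \<omega> \<bullet> E i
      = real n * \<mu> i * \<kappa> i / den n i * (\<kappa> i * (u \<bullet> E i) + \<eta> (F i) \<omega>)"
proof (induction n)
  case 0
  {
    case 1
    show ?case by (simp add: m_def)
  next
    case 2
    show ?case by (simp add: m_def)
  }
next
  case (Suc n)
  define Z where "Z = apply_operator M (kalman_gain A \<gamma> (cov n))
    (\<lambda>h \<omega>. single_draw_data A u \<eta> (Suc n) h \<omega> - A (m n \<omega>) \<bullet> h)"
  have m: "m (Suc n) \<omega> = m n \<omega> + Z \<omega>" for \<omega>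
    by (simp add: m_def Z_def)
  note Z = apply_gain[OF assms(1,2) Suc.IH(1), where n = n and u = u and j = "Suc n", folded Z_def]
  {
    case 1
    show ?case
    proof (rule borel_measurable_coords)
      fix i
      show "(\<lambda>\<omega>. m (Suc n) \<omega> \<bullet> E i) \<in> borel_measurable M"
        using borel_measurable_inner_left[OF Suc.IH(1), of "E i"] borel_measurable_inner_left[OF Z(1), of "E i"]
        unfolding m inner_add_left by measurable
    qed
  next
    case 2
    \<comment> \<open>As the datum \<open>y\<close> repeats, the update only changes its
      coefficient. The old one is damped by \<open>den n i / den (Suc n) i\<close>, which replaces
      its denominator; the gain adds one more summand over the same denominator.\<close>
    have *: "real n * \<mu> i * \<kappa> i / den n i * y + gain n i * (y - \<kappa> i * (real n * \<mu> i * \<kappa> i / den n i * y))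
      = real (Suc n) * \<mu> i * \<kappa> i / den (Suc n) i * y" for y
    proof -
      have lin: "c * y + g * (y - k * (c * y)) = (c * (1 - g * k) + g) * y" for c g k y :: real
        by (simp add: algebra_simps)
      have "real n * \<mu> i * \<kappa> i / den n i * (1 - gain n i * \<kappa> i) = real n * \<mu> i * \<kappa> i / den (Suc n) i"
        using den_pos[of n i] by (simp add: one_minus_gain)
      then have "real n * \<mu> i * \<kappa> i / den n i * (1 - gain n i * \<kappa> i) + gain n i
          = real (Suc n) * \<mu> i * \<kappa> i / den (Suc n) i"
        by (simp add: gain_def distrib_right add_divide_distrib)
      moreover have "real n * \<mu> i * \<kappa> i / den n i * y + gain n i * (y - \<kappa> i * (real n * \<mu> i * \<kappa> i / den n i * y))
          = (real n * \<mu> i * \<kappa> i / den n i * (1 - gain n i * \<kappa> i) + gain n i) * y"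
        by (rule lin)
      ultimately show ?thesis by simp
    qed
    show ?case
      using Suc.IH(2) Z(2)[of i]
    proof eventually_elim
      case (elim \<omega>)
      have "m (Suc n) \<omega> \<bullet> E i = m n \<omega> \<bullet> E i
          + gain n i * ((\<kappa> i * (u \<bullet> E i) + \<eta> (F i) \<omega>) - \<kappa> i * (m n \<omega> \<bullet> E i))"
        by (simp add: m inner_add_left elim(2) algebra_simps)
      then show ?case
        unfolding elim(1) * .
    qed
  }
qed

section \<open>Mean squared error in terms of t = n / \<alpha>\<close>

lemma mean_error_coord:
  fixes u :: 'x and n :: nat
  assumes "prob_space M" and wn: "white_noise M \<gamma> \<eta>"
  defines "m \<equiv> kalman_mean M A \<gamma> (\<lambda>x. (\<gamma>\<^sup>2 / \<alpha>) *\<^sub>R S x) 0 (single_draw_data A u \<eta>)"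
  defines "t \<equiv> real n / \<alpha>"
  shows "AE \<omega> in M. (m n \<omega> - u) \<bullet> E i
      = t * \<mu> i * \<kappa> i / (1 + t * \<mu> i * (\<kappa> i)\<^sup>2) * \<eta> (F i) \<omega>
        - 1 / (1 + t * (\<mu> i * (\<kappa> i)\<^sup>2)) * (u \<bullet> E i)"
proof -
  have den: "den n i = \<alpha> * (1 + t * \<mu> i * (\<kappa> i)\<^sup>2)"
    using \<alpha>_pos by (simp add: den_def t_def distrib_left)
  have pos: "1 + t * \<mu> i * (\<kappa> i)\<^sup>2 > 0"
    using \<alpha>_pos \<mu>_pos[of i] by (auto simp: t_def intro!: add_pos_nonneg)
  have 1: "real n * \<mu> i * \<kappa> i / den n i = t * \<mu> i * \<kappa> i / (1 + t * \<mu> i * (\<kappa> i)\<^sup>2)"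
    unfolding den using \<alpha>_pos by (simp add: t_def)
  have 2: "t * \<mu> i * \<kappa> i / (1 + t * \<mu> i * (\<kappa> i)\<^sup>2) * \<kappa> i = 1 - 1 / (1 + t * (\<mu> i * (\<kappa> i)\<^sup>2))"
    using pos by (simp add: field_simps power2_eq_square)
  show ?thesis
    using mean_coord(2)[OF assms(1,2), where u = u and n = n and i = i]
  proof eventually_elim
    case (elim \<omega>)
    have "(m n \<omega> - u) \<bullet> E i = t * \<mu> i * \<kappa> i / (1 + t * \<mu> i * (\<kappa> i)\<^sup>2) * \<eta> (F i) \<omega>
        + (t * \<mu> i * \<kappa> i / (1 + t * \<mu> i * (\<kappa> i)\<^sup>2) * \<kappa> i) * (u \<bullet> E i) - u \<bullet> E i"
      unfolding m_def inner_diff_left elim 1 by (simp only: distrib_left mult.assoc)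
    then show ?case
      unfolding 2 by (simp add: left_diff_distrib)
  qed
qed

text \<open>Parseval and Tonelli reduce the expectation to a series of coordinatewise second
  moments. Its finiteness yields integrability, and only then is the nonnegative integral read as a
  real one.\<close>

lemma mean_error_bound:
  fixes u :: 'x and n :: nat
  assumes "prob_space M" and wn: "white_noise M \<gamma> \<eta>"
  defines "m \<equiv> kalman_mean M A \<gamma> (\<lambda>x. (\<gamma>\<^sup>2 / \<alpha>) *\<^sub>R S x) 0 (single_draw_data A u \<eta>)"
  defines "t \<equiv> real n / \<alpha>"
  assumes b: "summable (\<lambda>i. (1 / (1 + t * (\<mu> i * (\<kappa> i)\<^sup>2)))\<^sup>2 * (u \<bullet> E i)\<^sup>2)"
      "(\<Sum>i. (1 / (1 + t * (\<mu> i * (\<kappa> i)\<^sup>2)))\<^sup>2 * (u \<bullet> E i)\<^sup>2) \<le> B"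
    and v: "summable (\<lambda>i. (t * \<mu> i * \<kappa> i / (1 + t * \<mu> i * (\<kappa> i)\<^sup>2))\<^sup>2)"
      "(\<Sum>i. (t * \<mu> i * \<kappa> i / (1 + t * \<mu> i * (\<kappa> i)\<^sup>2))\<^sup>2) \<le> V"
  shows "integrable M (\<lambda>\<omega>. (norm (m n \<omega> - u))\<^sup>2)"
    and "integral\<^sup>L M (\<lambda>\<omega>. (norm (m n \<omega> - u))\<^sup>2) \<le> 2 * B + 2 * \<gamma>\<^sup>2 * V"
proof -
  interpret prob_space M by fact
  define r where "r i = t * \<mu> i * \<kappa> i / (1 + t * \<mu> i * (\<kappa> i)\<^sup>2)" for i
  define a where "a i = (1 / (1 + t * (\<mu> i * (\<kappa> i)\<^sup>2)))\<^sup>2 * (u \<bullet> E i)\<^sup>2" for i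
  have mm: "m n \<in> borel_measurable M"
    unfolding m_def by (rule mean_coord(1)[OF assms(1,2)])
  have [measurable]: "(\<lambda>\<omega>. (m n \<omega> - u) \<bullet> E i) \<in> borel_measurable M" for i
    using borel_measurable_inner_left[OF mm, of "E i"] unfolding inner_diff_left by measurable
  note [measurable] = white_noise_measurable[OF wn]
  have norm_eq: "ennreal ((norm (m n \<omega> - u))\<^sup>2) = (\<Sum>i. ennreal (((m n \<omega> - u) \<bullet> E i)\<^sup>2))" for \<omega>
    using parseval[of "m n \<omega> - u"] by (subst suminf_ennreal_eq) auto
  have meas: "(\<lambda>\<omega>. (norm (m n \<omega> - u))\<^sup>2) \<in> borel_measurable M"
  proof -
    have "(norm (m n \<omega> - u))\<^sup>2 = (\<Sum>i. ((m n \<omega> - u) \<bullet> E i)\<^sup>2)" for \<omega>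
      using parseval sums_unique by blast
    then show ?thesis by simp
  qed
  have term_le: "(\<integral>\<^sup>+\<omega>. ennreal (((m n \<omega> - u) \<bullet> E i)\<^sup>2) \<partial>M) \<le> ennreal (2 * a i + 2 * \<gamma>\<^sup>2 * (r i)\<^sup>2)" for i
  proof -
    have "AE \<omega> in M. ennreal (((m n \<omega> - u) \<bullet> E i)\<^sup>2)
        \<le> ennreal (2 * a i) + ennreal (2 * (r i)\<^sup>2) * ennreal ((\<eta> (F i) \<omega>)\<^sup>2)"
      using mean_error_coord[OF assms(1,2), of u n i]
    proof eventually_elim
      case (elim \<omega>)
      have sq: "(x - y)\<^sup>2 \<le> 2 * x\<^sup>2 + 2 * y\<^sup>2" for x y :: real
        using zero_le_power2[of "x + y"] by (simp add: power2_eq_square algebra_simps)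
      have "((m n \<omega> - u) \<bullet> E i)\<^sup>2 \<le> 2 * (r i * \<eta> (F i) \<omega>)\<^sup>2 + 2 * a i"
      proof -
        have 1: "(m n \<omega> - u) \<bullet> E i = r i * \<eta> (F i) \<omega> - 1 / (1 + t * (\<mu> i * (\<kappa> i)\<^sup>2)) * (u \<bullet> E i)"
          using elim unfolding m_def t_def r_def .
        have 2: "a i = (1 / (1 + t * (\<mu> i * (\<kappa> i)\<^sup>2)) * (u \<bullet> E i))\<^sup>2"
          unfolding a_def by (rule power_mult_distrib[symmetric])
        show ?thesis
          unfolding 1 2 by (rule sq)
      qed
      then have "ennreal (((m n \<omega> - u) \<bullet> E i)\<^sup>2) \<le> ennreal (2 * a i + 2 * (r i)\<^sup>2 * (\<eta> (F i) \<omega>)\<^sup>2)"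
        by (intro ennreal_leI) (simp add: power_mult_distrib)
      then show ?case
        by (simp add: ennreal_plus ennreal_mult a_def)
    qed
    then have "(\<integral>\<^sup>+\<omega>. ennreal (((m n \<omega> - u) \<bullet> E i)\<^sup>2) \<partial>M)
        \<le> (\<integral>\<^sup>+\<omega>. ennreal (2 * a i) + ennreal (2 * (r i)\<^sup>2) * ennreal ((\<eta> (F i) \<omega>)\<^sup>2) \<partial>M)"
      by (rule nn_integral_mono_AE)
    also have "\<dots> = ennreal (2 * a i) + ennreal (2 * (r i)\<^sup>2) * ennreal (\<gamma>\<^sup>2 * (norm (F i))\<^sup>2)"
      by (simp add: nn_integral_add nn_integral_cmult emeasure_space_1
          white_noise_second_moment[OF assms(1,2) \<gamma>_pos])
    also have "\<dots> = ennreal (2 * a i + 2 * \<gamma>\<^sup>2 * (r i)\<^sup>2)"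
      by (simp add: power2_norm_eq_inner orthonormal_seq_inner[OF ortho_F] a_def mult_ac
          flip: ennreal_mult ennreal_plus)
    finally show ?thesis .
  qed
  have sums: "summable (\<lambda>i. 2 * a i + 2 * \<gamma>\<^sup>2 * (r i)\<^sup>2)"
    using b(1) v(1) unfolding a_def[symmetric] r_def[symmetric]
    by (intro summable_add summable_mult)
  have "(\<Sum>i. 2 * a i + 2 * \<gamma>\<^sup>2 * (r i)\<^sup>2) = 2 * (\<Sum>i. a i) + 2 * \<gamma>\<^sup>2 * (\<Sum>i. (r i)\<^sup>2)"
    using b(1) v(1) unfolding a_def[symmetric] r_def[symmetric]
    by (subst suminf_add[symmetric]) (auto simp: suminf_mult summable_mult)
  also have "\<dots> \<le> 2 * B + 2 * \<gamma>\<^sup>2 * V"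
    using b(2) v(2) unfolding a_def[symmetric] r_def[symmetric]
    by (intro add_mono mult_left_mono) auto
  finally have le: "(\<Sum>i. 2 * a i + 2 * \<gamma>\<^sup>2 * (r i)\<^sup>2) \<le> 2 * B + 2 * \<gamma>\<^sup>2 * V" .
  \<comment> \<open>Since \<open>ennreal\<close> truncates negative numbers to 0, the bound must be
    known to be nonnegative before the inequality is transferred back to the reals.\<close>
  have nonneg: "0 \<le> (\<Sum>i. 2 * a i + 2 * \<gamma>\<^sup>2 * (r i)\<^sup>2)"
    by (rule suminf_nonneg[OF sums]) (simp add: a_def)
  have "(\<integral>\<^sup>+\<omega>. ennreal ((norm (m n \<omega> - u))\<^sup>2) \<partial>M) = (\<Sum>i. \<integral>\<^sup>+\<omega>. ennreal (((m n \<omega> - u) \<bullet> E i)\<^sup>2) \<partial>M)"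
    unfolding norm_eq by (rule nn_integral_suminf) measurable
  also have "\<dots> \<le> (\<Sum>i. ennreal (2 * a i + 2 * \<gamma>\<^sup>2 * (r i)\<^sup>2))"
    by (intro suminf_le term_le) auto
  also have "\<dots> = ennreal (\<Sum>i. 2 * a i + 2 * \<gamma>\<^sup>2 * (r i)\<^sup>2)"
    by (rule suminf_ennreal2[OF _ sums]) (simp add: a_def)
  also have "\<dots> \<le> ennreal (2 * B + 2 * \<gamma>\<^sup>2 * V)"
    by (rule ennreal_leI[OF le])
  finally have nn: "(\<integral>\<^sup>+\<omega>. ennreal ((norm (m n \<omega> - u))\<^sup>2) \<partial>M) \<le> ennreal (2 * B + 2 * \<gamma>\<^sup>2 * V)" .
  then show int: "integrable M (\<lambda>\<omega>. (norm (m n \<omega> - u))\<^sup>2)"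
    using meas by (intro integrableI_bounded) (auto intro: le_less_trans)
  show "integral\<^sup>L M (\<lambda>\<omega>. (norm (m n \<omega> - u))\<^sup>2) \<le> 2 * B + 2 * \<gamma>\<^sup>2 * V"
    using nn le nonneg by (subst (asm) nn_integral_eq_integral[OF int]) auto
qed

end

section \<open>Rates\<close>

lemma compact_operator_bounded_linear:
  assumes "compact_operator A"
  shows "bounded_linear A"
proof -
  have lin: "linear A" and "compact (closure (A ` cball 0 1))"
    using assms by (auto simp: compact_operator_def)
  then have "bounded (A ` cball 0 1)"
    using bounded_closure_image compact_imp_bounded bounded_subset closure_subset by blast
  then obtain B where B: "\<And>x. norm x \<le> 1 \<Longrightarrow> norm (A x) \<le> B"
    by (metis bounded_iff image_eqI mem_cball_0)
  interpret linear A by fact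
  have "norm (A x) \<le> norm x * B" for x
  proof (cases "x = 0")
    case True
    then show ?thesis by (simp add: zero)
  next
    case False
    have "norm (A (inverse (norm x) *\<^sub>R x)) \<le> B"
      using False by (intro B) simp
    then show ?thesis
      using False by (simp add: scaleR field_simps)
  qed
  then show ?thesis
    by (intro bounded_linear_intro[where K = B] add scaleR)
qed

lemma atLeast1_eq_range_Suc: "{1..} = range Suc"
  by (auto simp: image_iff) (metis Suc_le_D)

lemma summable_on_atLeast1_iff:
  fixes f :: "nat \<Rightarrow> real"
  assumes "\<And>i. f i \<ge> 0"
  shows "f summable_on {1..} \<longleftrightarrow> summable (\<lambda>i. f (Suc i))"
proof -
  have "f summable_on {1..} \<longleftrightarrow> (f \<circ> Suc) summable_on UNIV"
    unfolding atLeast1_eq_range_Suc by (rule summable_on_reindex) simp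
  then show ?thesis
    using assms by (simp add: summable_on_UNIV_nonneg_real_iff o_def)
qed

text \<open>The constant is 2 * c1 + 2 * c2, where c1 contains the source sum of \<open>u\<close>
  and c2 comes from the variance sum. It is fixed before \<alpha>, \<gamma>, n, the probability
  space and the noise, which gives the uniformity; c2 keeps it positive even for \<open>u\<close> =
  0.\<close>

lemma kalman_rate:
  fixes A :: "'x::{real_inner, complete_space} \<Rightarrow> 'y::{real_inner, complete_space}"
    and \<Sigma>0 :: "'x \<Rightarrow> 'x"
    and e :: "nat \<Rightarrow> 'x"
    and \<kappa> :: "nat \<Rightarrow> real"
    and u :: 'x
    and \<epsilon> p c \<beta> :: real
  assumes A: "compact_operator A"
    and \<Sigma>0: "bounded_linear \<Sigma>0"
    and e: "orthonormal_basis {1..} e"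
    and pos: "\<epsilon> > 0" "p > 0" "c \<ge> 1"
    and \<Sigma>0_e: "\<And>i. i \<ge> 1 \<Longrightarrow> \<Sigma>0 (e i) = (real i powr (- 1 - 2 * \<epsilon>)) *\<^sub>R e i"
    and AA: "\<And>i. i \<ge> 1 \<Longrightarrow> adjoint A (A (e i)) = (\<kappa> i)\<^sup>2 *\<^sub>R e i"
    and \<kappa>: "\<And>i. i \<ge> 1 \<Longrightarrow> inverse c * real i powr (- p) \<le> \<kappa> i \<and> \<kappa> i \<le> c * real i powr (- p)"
    and \<beta>: "0 \<le> \<beta>" "\<beta> \<le> 1 + 2 * \<epsilon> + p"
    and u: "(\<lambda>i. (u \<bullet> e i)\<^sup>2 * real i powr (2 * \<beta>)) summable_on {1..}"
  obtains C where "C > 0"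
    "\<And>\<alpha> \<gamma> n (M :: 'w measure) \<eta>.
        \<alpha> > 0 \<Longrightarrow> \<gamma> > 0 \<Longrightarrow> n \<ge> 1 \<Longrightarrow> prob_space M \<Longrightarrow> white_noise M \<gamma> \<eta> \<Longrightarrow>
        (let m = kalman_mean M A \<gamma> (\<lambda>x. (\<gamma>\<^sup>2 / \<alpha>) *\<^sub>R \<Sigma>0 x) 0 (single_draw_data A u \<eta>) in
          integrable M (\<lambda>\<omega>. (norm (m n \<omega> - u))\<^sup>2) \<and>
          integral\<^sup>L M (\<lambda>\<omega>. (norm (m n \<omega> - u))\<^sup>2)
            \<le> C * ((\<alpha> / real n) powr (2 * \<beta> / (1 + 2 * \<epsilon> + 2 * p))
                 + \<gamma>\<^sup>2 * (real n / \<alpha>) powr ((1 + 2 * p) / (1 + 2 * \<epsilon> + 2 * p))))"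
proof
  \<comment> \<open>The locales count from 0, the eigenvalue laws from 1; hence \<open>Suc i\<close>
    in all powers below.\<close>
  define E where "E i = e (Suc i)" for i
  define k where "k i = \<kappa> (Suc i)" for i
  define \<mu> where "\<mu> i = real (Suc i) powr (- 1 - 2 * \<epsilon>)" for i
  define s where "s = 1 + 2 * \<epsilon> + 2 * p"
  define w where "w i = (u \<bullet> E i)\<^sup>2 * real (Suc i) powr (2 * \<beta>)" for i
  define c1 where "c1 = c ^ 4 * (\<Sum>i. w i)"
  define c2 where "c2 = c\<^sup>2 * (2 + 1 / (1 + 4 * \<epsilon> + 2 * p))"
  have w: "summable w" "\<And>i. w i \<ge> 0"
    using u by (subst (asm) summable_on_atLeast1_iff) (simp_all add: w_def[abs_def] E_def)
  have c1: "c1 \<ge> 0"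
    unfolding c1_def using suminf_nonneg[OF w] by simp
  have c2: "c2 > 0"
    using pos by (simp add: c2_def add_pos_pos)
  show "2 * c1 + 2 * c2 > 0"
    using c1 c2 by simp
  have k: "inverse c * real (Suc i) powr (- p) \<le> k i" "k i \<le> c * real (Suc i) powr (- p)" for i
    using \<kappa>[of "Suc i"] by (simp_all add: k_def)
  have k_pos: "k i > 0" for i
    by (rule less_le_trans[OF _ k(1)]) (use pos in simp)
  have \<mu>_pos: "\<mu> i > 0" for i
    by (simp add: \<mu>_def)
  have hs: "summable (\<lambda>i. (\<mu> i * k i)\<^sup>2)"
  proof (rule summable_comparison_test_ev[OF always_eventually])
    have "summable (\<lambda>i. real (Suc i) powr (- 2 - 4 * \<epsilon> - 2 * p))"
      using pos by (subst summable_Suc_iff) (simp add: summable_real_powr_iff)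
    then show "summable (\<lambda>i. c\<^sup>2 * real (Suc i) powr (- 2 - 4 * \<epsilon> - 2 * p))"
      by (rule summable_mult)
    show "\<forall>i. norm ((\<mu> i * k i)\<^sup>2) \<le> c\<^sup>2 * real (Suc i) powr (- 2 - 4 * \<epsilon> - 2 * p)"
    proof
      fix i
      have "\<mu> i * k i \<le> \<mu> i * (c * real (Suc i) powr (- p))"
        using k(2) \<mu>_pos[of i] by (intro mult_left_mono) auto
      also have "\<dots> = c * real (Suc i) powr (- 1 - 2 * \<epsilon> - p)"
        unfolding \<mu>_def by (simp add: powr_diff powr_minus_divide)
      finally have "(\<mu> i * k i)\<^sup>2 \<le> (c * real (Suc i) powr (- 1 - 2 * \<epsilon> - p))\<^sup>2"
        using k_pos[of i] \<mu>_pos[of i] by (intro power_mono) auto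
      also have "\<dots> = c\<^sup>2 * real (Suc i) powr (- 2 - 4 * \<epsilon> - 2 * p)"
        by (simp add: power_mult_distrib powr_power algebra_simps)
      finally show "norm ((\<mu> i * k i)\<^sup>2) \<le> c\<^sup>2 * real (Suc i) powr (- 2 - 4 * \<epsilon> - 2 * p)"
        by simp
    qed
  qed
  have l: "\<mu> i * (k i)\<^sup>2 \<ge> (inverse c)\<^sup>2 * real (Suc i) powr (- s)" for i
  proof -
    have "(inverse c)\<^sup>2 * real (Suc i) powr (- s) = \<mu> i * (inverse c * real (Suc i) powr (- p))\<^sup>2"
      unfolding \<mu>_def s_def
      by (simp add: power_mult_distrib powr_power mult_ac flip: powr_add)
    also have "\<dots> \<le> \<mu> i * (k i)\<^sup>2"
      using k(1) \<mu>_pos[of i] pos by (intro mult_left_mono power_mono) auto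
    finally show ?thesis .
  qed
  have range_E: "range E = e ` {1..}"
    unfolding atLeast1_eq_range_Suc by (simp add: E_def image_image)
  fix \<alpha> \<gamma> :: real and n :: nat and M :: "'w measure" and \<eta> :: "'y \<Rightarrow> 'w \<Rightarrow> real"
  assume \<alpha>: "\<alpha> > 0" and \<gamma>: "\<gamma> > 0" and n: "n \<ge> 1"
    and M: "prob_space M" and \<eta>: "white_noise M \<gamma> \<eta>"
  interpret kalman_filter E A k \<Sigma>0 \<mu> \<alpha> \<gamma>
  proof (intro kalman_filter.intro singular_system.intro hilbert_basis.intro
      singular_system_axioms.intro kalman_filter_axioms.intro)
    show "orthonormal_seq E" "closure (span (range E)) = UNIV"
      using e unfolding range_E by (auto simp: orthonormal_basis_def orthonormal_seq_def E_def)
  qed (use \<Sigma>0_e AA k_pos \<mu>_pos hs \<alpha> \<gamma> \<Sigma>0 compact_operator_bounded_linear[OF A] in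
      \<open>auto simp: E_def k_def \<mu>_def\<close>)
  define t where "t = real n / \<alpha>"
  have t: "t > 0"
    using \<alpha> n by (simp add: t_def)
  have b_le: "(1 / (1 + t * (\<mu> i * (k i)\<^sup>2)))\<^sup>2 * (u \<bullet> E i)\<^sup>2 \<le> c ^ 4 * t powr (- (2 * \<beta> / s)) * w i" for i
  proof -
    have "(1 / (1 + t * (\<mu> i * (k i)\<^sup>2)))\<^sup>2 \<le> c ^ 4 * t powr (- (2 * \<beta> / s)) * real (Suc i) powr (2 * \<beta>)"
      using pos \<beta> t l[of i] by (intro bias_factor_le) (auto simp: s_def)
    from mult_right_mono[OF this, of "(u \<bullet> E i)\<^sup>2"] show ?thesis
      by (simp add: w_def mult_ac)
  qed
  have w': "summable (\<lambda>i. c ^ 4 * t powr (- (2 * \<beta> / s)) * w i)"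
    using w(1) by (rule summable_mult)
  have b: "summable (\<lambda>i. (1 / (1 + t * (\<mu> i * (k i)\<^sup>2)))\<^sup>2 * (u \<bullet> E i)\<^sup>2)"
    by (rule summable_comparison_test_ev[OF always_eventually w']) (use b_le in auto)
  have "(\<Sum>i. (1 / (1 + t * (\<mu> i * (k i)\<^sup>2)))\<^sup>2 * (u \<bullet> E i)\<^sup>2) \<le> (\<Sum>i. c ^ 4 * t powr (- (2 * \<beta> / s)) * w i)"
    by (rule suminf_le[OF b_le b w'])
  also have "\<dots> = c1 * t powr (- (2 * \<beta> / s))"
    by (simp add: c1_def suminf_mult[OF w(1)])
  finally have b2: "(\<Sum>i. (1 / (1 + t * (\<mu> i * (k i)\<^sup>2)))\<^sup>2 * (u \<bullet> E i)\<^sup>2) \<le> c1 * t powr (- (2 * \<beta> / s))" .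
  have v_le: "(\<Sum>i<N. (t * \<mu> i * k i / (1 + t * \<mu> i * (k i)\<^sup>2))\<^sup>2) \<le> c2 * t powr ((1 + 2 * p) / s)" for N
    using variance_sum_le[OF pos t \<kappa>, of N] by (simp add: k_def \<mu>_def c2_def s_def)
  have v: "summable (\<lambda>i. (t * \<mu> i * k i / (1 + t * \<mu> i * (k i)\<^sup>2))\<^sup>2)"
    by (rule summableI_nonneg_bounded[OF _ v_le]) simp
  have v2: "(\<Sum>i. (t * \<mu> i * k i / (1 + t * \<mu> i * (k i)\<^sup>2))\<^sup>2) \<le> c2 * t powr ((1 + 2 * p) / s)"
    by (rule suminf_le_const[OF v v_le])
  note bound = mean_error_bound[OF M \<eta> b[unfolded t_def] b2[unfolded t_def] v[unfolded t_def] v2[unfolded t_def]]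
  have "2 * (c1 * t powr (- (2 * \<beta> / s))) + 2 * \<gamma>\<^sup>2 * (c2 * t powr ((1 + 2 * p) / s))
      \<le> (2 * c1 + 2 * c2) * (t powr (- (2 * \<beta> / s)) + \<gamma>\<^sup>2 * t powr ((1 + 2 * p) / s))"
    using c1 c2 by (simp add: distrib_left distrib_right)
  moreover have "t powr (- (2 * \<beta> / s)) = (\<alpha> / real n) powr (2 * \<beta> / s)"
    using \<alpha> n by (simp add: t_def powr_minus_divide powr_divide)
  ultimately show "let m = kalman_mean M A \<gamma> (\<lambda>x. (\<gamma>\<^sup>2 / \<alpha>) *\<^sub>R \<Sigma>0 x) 0 (single_draw_data A u \<eta>) in
          integrable M (\<lambda>\<omega>. (norm (m n \<omega> - u))\<^sup>2) \<and>
          integral\<^sup>L M (\<lambda>\<omega>. (norm (m n \<omega> - u))\<^sup>2)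
            \<le> (2 * c1 + 2 * c2) * ((\<alpha> / real n) powr (2 * \<beta> / (1 + 2 * \<epsilon> + 2 * p))
                 + \<gamma>\<^sup>2 * (real n / \<alpha>) powr ((1 + 2 * p) / (1 + 2 * \<epsilon> + 2 * p)))"
    using bound unfolding Let_def s_def t_def by (auto intro: order_trans)
qed

theorem theorem4:
  fixes A :: "'x::{real_inner, complete_space} \<Rightarrow> 'y::{real_inner, complete_space}"
    and \<Sigma>0 :: "'x \<Rightarrow> 'x"
    and e :: "nat \<Rightarrow> 'x"
    and \<kappa> :: "nat \<Rightarrow> real"
    and u :: 'x
    and \<epsilon> p c \<beta> :: real
  assumes "compact_operator A"
    and "bounded_linear \<Sigma>0"
    and "orthonormal_basis {1..} e"
    and "\<epsilon> > 0" and "p > 0" and "c \<ge> 1"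
    and "\<And>i. i \<ge> 1 \<Longrightarrow> \<Sigma>0 (e i) = (real i powr (- 1 - 2 * \<epsilon>)) *\<^sub>R e i"
    and "\<And>i. i \<ge> 1 \<Longrightarrow> adjoint A (A (e i)) = (\<kappa> i)\<^sup>2 *\<^sub>R e i"
    and "\<And>i. i \<ge> 1 \<Longrightarrow> inverse c * real i powr (- p) \<le> \<kappa> i \<and> \<kappa> i \<le> c * real i powr (- p)"
    and "0 \<le> \<beta>" and "\<beta> \<le> 1 + 2 * \<epsilon> + p"
    and "(\<lambda>i. (u \<bullet> e i)\<^sup>2 * real i powr (2 * \<beta>)) summable_on {1..}"
  shows
    "(\<exists>C>0. \<forall>\<alpha>>0. \<forall>\<gamma>>0. \<forall>n\<ge>1. \<forall>(M :: 'w measure) \<eta>.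
        prob_space M \<longrightarrow> white_noise M \<gamma> \<eta> \<longrightarrow>
        (let m = kalman_mean M A \<gamma> (\<lambda>x. (\<gamma>\<^sup>2 / \<alpha>) *\<^sub>R \<Sigma>0 x) 0 (single_draw_data A u \<eta>) in
          integrable M (\<lambda>\<omega>. (norm (m n \<omega> - u))\<^sup>2) \<and>
          integral\<^sup>L M (\<lambda>\<omega>. (norm (m n \<omega> - u))\<^sup>2)
            \<le> C * ((\<alpha> / real n) powr (2 * \<beta> / (1 + 2 * \<epsilon> + 2 * p))
                 + \<gamma>\<^sup>2 * (real n / \<alpha>) powr ((1 + 2 * p) / (1 + 2 * \<epsilon> + 2 * p)))))
     \<and>
     (\<exists>C>0. \<forall>N\<ge>1. \<forall>\<gamma>>0. \<forall>(M :: 'w measure) \<eta>.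
        \<gamma>\<^sup>2 = real N powr (- ((1 + 2 * \<beta> + 2 * p) / (1 + 2 * \<epsilon> + 2 * p))) \<longrightarrow>
        prob_space M \<longrightarrow> white_noise M \<gamma> \<eta> \<longrightarrow>
        (let m = kalman_mean M A \<gamma> (\<lambda>x. (\<gamma>\<^sup>2 / 1) *\<^sub>R \<Sigma>0 x) 0 (single_draw_data A u \<eta>) in
          integrable M (\<lambda>\<omega>. (norm (m N \<omega> - u))\<^sup>2) \<and>
          integral\<^sup>L M (\<lambda>\<omega>. (norm (m N \<omega> - u))\<^sup>2)
            \<le> C * real N powr (- (2 * \<beta> / (1 + 2 * \<epsilon> + 2 * p)))))"
proof -
  obtain C where C: "C > 0"
    "\<And>\<alpha> \<gamma> n (M :: 'w measure) \<eta>.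
        \<alpha> > 0 \<Longrightarrow> \<gamma> > 0 \<Longrightarrow> n \<ge> 1 \<Longrightarrow> prob_space M \<Longrightarrow> white_noise M \<gamma> \<eta> \<Longrightarrow>
        (let m = kalman_mean M A \<gamma> (\<lambda>x. (\<gamma>\<^sup>2 / \<alpha>) *\<^sub>R \<Sigma>0 x) 0 (single_draw_data A u \<eta>) in
          integrable M (\<lambda>\<omega>. (norm (m n \<omega> - u))\<^sup>2) \<and>
          integral\<^sup>L M (\<lambda>\<omega>. (norm (m n \<omega> - u))\<^sup>2)
            \<le> C * ((\<alpha> / real n) powr (2 * \<beta> / (1 + 2 * \<epsilon> + 2 * p))
                 + \<gamma>\<^sup>2 * (real n / \<alpha>) powr ((1 + 2 * p) / (1 + 2 * \<epsilon> + 2 * p))))"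
    using kalman_rate[OF assms] by blast
  define s where "s = 1 + 2 * \<epsilon> + 2 * p"
  have s: "s > 0"
    using assms(4,5) by (simp add: s_def)
  \<comment> \<open>The prescribed noise level is the one that balances the two terms: both become
    N^(-2\<beta>/s), and the constant doubles.\<close>
  have rate: "C * ((1 / real N) powr (2 * \<beta> / s) + \<gamma>\<^sup>2 * (real N / 1) powr ((1 + 2 * p) / s))
      = 2 * C * real N powr (- (2 * \<beta> / s))"
    if "N \<ge> 1" "\<gamma>\<^sup>2 = real N powr (- ((1 + 2 * \<beta> + 2 * p) / s))" for N :: nat and \<gamma>
  proof -
    have "- ((1 + 2 * \<beta> + 2 * p) / s) + (1 + 2 * p) / s = - (2 * \<beta> / s)"
      using s by (simp add: field_simps)
    then have "\<gamma>\<^sup>2 * real N powr ((1 + 2 * p) / s) = real N powr (- (2 * \<beta> / s))"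
      unfolding that(2) powr_add[symmetric] by simp
    moreover have "(1 / real N) powr (2 * \<beta> / s) = real N powr (- (2 * \<beta> / s))"
      using that(1) by (simp add: powr_divide powr_minus_divide)
    ultimately show ?thesis by simp
  qed
  show ?thesis
  proof
    show "\<exists>C>0. \<forall>\<alpha>>0. \<forall>\<gamma>>0. \<forall>n\<ge>1. \<forall>(M :: 'w measure) \<eta>.
        prob_space M \<longrightarrow> white_noise M \<gamma> \<eta> \<longrightarrow>
        (let m = kalman_mean M A \<gamma> (\<lambda>x. (\<gamma>\<^sup>2 / \<alpha>) *\<^sub>R \<Sigma>0 x) 0 (single_draw_data A u \<eta>) in
          integrable M (\<lambda>\<omega>. (norm (m n \<omega> - u))\<^sup>2) \<and>
          integral\<^sup>L M (\<lambda>\<omega>. (norm (m n \<omega> - u))\<^sup>2)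
            \<le> C * ((\<alpha> / real n) powr (2 * \<beta> / (1 + 2 * \<epsilon> + 2 * p))
                 + \<gamma>\<^sup>2 * (real n / \<alpha>) powr ((1 + 2 * p) / (1 + 2 * \<epsilon> + 2 * p))))"
      using C(1) by (intro exI[of _ C] conjI allI impI C(2))
    show "\<exists>C>0. \<forall>N\<ge>1. \<forall>\<gamma>>0. \<forall>(M :: 'w measure) \<eta>.
        \<gamma>\<^sup>2 = real N powr (- ((1 + 2 * \<beta> + 2 * p) / (1 + 2 * \<epsilon> + 2 * p))) \<longrightarrow>
        prob_space M \<longrightarrow> white_noise M \<gamma> \<eta> \<longrightarrow>
        (let m = kalman_mean M A \<gamma> (\<lambda>x. (\<gamma>\<^sup>2 / 1) *\<^sub>R \<Sigma>0 x) 0 (single_draw_data A u \<eta>) in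
          integrable M (\<lambda>\<omega>. (norm (m N \<omega> - u))\<^sup>2) \<and>
          integral\<^sup>L M (\<lambda>\<omega>. (norm (m N \<omega> - u))\<^sup>2)
            \<le> C * real N powr (- (2 * \<beta> / (1 + 2 * \<epsilon> + 2 * p))))"
    proof (intro exI[of _ "2 * C"] conjI allI impI)
      fix N :: nat and \<gamma> :: real and M :: "'w measure" and \<eta> :: "'y \<Rightarrow> 'w \<Rightarrow> real"
      assume "1 \<le> N" "0 < \<gamma>" "prob_space M" "white_noise M \<gamma> \<eta>"
        and \<gamma>2: "\<gamma>\<^sup>2 = real N powr (- ((1 + 2 * \<beta> + 2 * p) / (1 + 2 * \<epsilon> + 2 * p)))"
      then have "1 \<le> N" "\<gamma>\<^sup>2 = real N powr (- ((1 + 2 * \<beta> + 2 * p) / s))"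
        by (simp_all add: s_def)
      note rate = rate[OF this, unfolded s_def]
      show "let m = kalman_mean M A \<gamma> (\<lambda>x. (\<gamma>\<^sup>2 / 1) *\<^sub>R \<Sigma>0 x) 0 (single_draw_data A u \<eta>) in
          integrable M (\<lambda>\<omega>. (norm (m N \<omega> - u))\<^sup>2) \<and>
          integral\<^sup>L M (\<lambda>\<omega>. (norm (m N \<omega> - u))\<^sup>2)
            \<le> 2 * C * real N powr (- (2 * \<beta> / (1 + 2 * \<epsilon> + 2 * p)))"
        using C(2)[of 1 \<gamma> N M \<eta>] \<open>1 \<le> N\<close> \<open>0 < \<gamma>\<close> \<open>prob_space M\<close> \<open>white_noise M \<gamma> \<eta>\<close>
        unfolding rate by simp
    qed (use C(1) in simp)
  qed
qed

end
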